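(* Let $(X,\mathcal{B},\mu,T)$ be a measure-preserving transformation of type $\mathbf{II}_\infty$. Then $$h_{Pa}(X,\mathcal{B},\mu,T)\le h(X^*,\mathcal{B}^*,\mu^*,T_* ).$$
   Context: Let $(X,\mathcal{B},\mu)$ be a standard $\sigma$-finite measure space and $T$ a measure-preserving transformation. Type $\mathbf{II}_\infty$: $T$ is conservative and there is no $T$-invariant set of finite positive measure. Poisson suspension: $X^*$ is the space of (counting) measures $\gamma$ on $X$; $\mathcal{B}^*$ is generated by the maps $N(B):\gamma\mapsto\gamma(B)$, $B\in\mathcal{B}$. The measure $\mu^*$ is the probability measure under which $N(B_i)$ are independent for disjoint $B_i$ and $N(B)$ is Poisson with parameter $\mu(B)$ (a.s. infinite if $\mu(B)=\infty$). The map is $T_*\gamma=\gamma\circ T^{-1}$. The quantity $h(X^*,\mathcal{B}^*,\mu^*,T_* )$ is the Kolmogorov–Sinai entropy (the "Poisson entropy" of $T$). Conditional entropy: for sub-$\sigma$-algebras $\mathcal{C}$ and $\sigma$-finite $\mathcal{D}$, $H_\mu(\mathcal{C}\mid\mathcal{D})=\int_X H_{\mu_x}(\mathcal{C})\,d\mu(x)$. Here $\mu_x$ is the conditional probability of $\mu$ on the $\mathcal{D}$-atom of $x$, and $H_{\mu_x}(\mathcal{C})$ is the Shannon entropy of the partition induced by $\mathcal{C}$ under $\mu_x$. Parry entropy: $$h_{Pa}(X,\mathcal{B},\mu,T):=\sup\{H_\mu(\mathcal{C}\mid T^{-1}\mathcal{C})\},$$ where the supremum is over $\sigma$-finite sub-$\sigma$-algebras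 $\mathcal{C}\subset\mathcal{B}$ with $T^{-1}\mathcal{C}\subset\mathcal{C}$. *)

theory Defs
  imports "HOL-Probability.Probability"
begin

definition measure_preserving :: "'a measure \<Rightarrow> ('a \<Rightarrow> 'a) \<Rightarrow> bool" where
  "measure_preserving M T \<longleftrightarrow> T \<in> M \<rightarrow>\<^sub>M M \<and> distr M M T = M"

definition conservative :: "'a measure \<Rightarrow> ('a \<Rightarrow> 'a) \<Rightarrow> bool" where
  "conservative M T \<longleftrightarrow>
     (\<forall>W\<in>sets M. (\<forall>n::nat. n \<ge> 1 \<longrightarrow> W \<inter> (T ^^ n) -` W = {}) \<longrightarrow> emeasure M W = 0)"

definition type_II_infty :: "'a measure \<Rightarrow> ('a \<Rightarrow> 'a) \<Rightarrow> bool" where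
  "type_II_infty M T \<longleftrightarrow> measure_preserving M T \<and> conservative M T \<and>
     \<not> (\<exists>A\<in>sets M. T -` A \<inter> space M = A \<and> 0 < emeasure M A \<and> emeasure M A < \<infinity>)"

definition counting_measures :: "'a measure \<Rightarrow> ('a set \<Rightarrow> ennreal) set" where
  "counting_measures M = {\<gamma>. measure_space (space M) (sets M) \<gamma> \<and>
       (\<forall>B\<in>sets M. \<gamma> B \<in> range of_nat \<union> {\<infinity>}) \<and> (\<forall>B. B \<notin> sets M \<longrightarrow> \<gamma> B = 0)}"

definition poisson_space :: "'a measure \<Rightarrow> ('a set \<Rightarrow> ennreal) measure" where
  "poisson_space M = sigma (counting_measures M)
     {{\<gamma> \<in> counting_measures M. \<gamma> B \<in> S} | B S. B \<in> sets M \<and> S \<in> sets (borel :: ennreal measure)}"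

definition push_counting :: "'a measure \<Rightarrow> ('a \<Rightarrow> 'a) \<Rightarrow> ('a set \<Rightarrow> ennreal) \<Rightarrow> ('a set \<Rightarrow> ennreal)" where
  "push_counting M T \<gamma> = (\<lambda>B. if B \<in> sets M then \<gamma> (T -` B \<inter> space M) else 0)"

definition is_poisson_measure :: "'a measure \<Rightarrow> ('a set \<Rightarrow> ennreal) measure \<Rightarrow> bool" where
  "is_poisson_measure M P \<longleftrightarrow>
     sets P = sets (poisson_space M) \<and> prob_space P \<and>
     (\<forall>(n::nat) (B::nat \<Rightarrow> 'a set) (k::nat \<Rightarrow> nat).
        (\<forall>i<n. B i \<in> sets M \<and> emeasure M (B i) < \<infinity>) \<and> disjoint_family_on B {..<n} \<longrightarrow>
        measure P {\<gamma> \<in> space P. \<forall>i<n. \<gamma> (B i) = of_nat (k i)} =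
          (\<Prod>i<n. exp (- measure M (B i)) * measure M (B i) ^ k i / fact (k i))) \<and>
     (\<forall>B\<in>sets M. emeasure M B = \<infinity> \<longrightarrow> measure P {\<gamma> \<in> space P. \<gamma> B = \<infinity>} = 1)"

definition fin_partition :: "'b measure \<Rightarrow> 'b set set \<Rightarrow> bool" where
  "fin_partition Q P \<longleftrightarrow> finite P \<and> P \<subseteq> sets Q \<and> disjoint P \<and> \<Union>P = space Q"

definition part_entropy :: "'b measure \<Rightarrow> 'b set set \<Rightarrow> real" where
  "part_entropy Q P = (\<Sum>A\<in>P. - measure Q A * ln (measure Q A))"

definition iter_join :: "'b measure \<Rightarrow> ('b \<Rightarrow> 'b) \<Rightarrow> 'b set set \<Rightarrow> nat \<Rightarrow> 'b set set" where
  "iter_join Q S P n = {space Q \<inter> (\<Inter>i<n. (S ^^ i) -` f i) | f. \<forall>i<n. f i \<in> P}"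

definition ks_entropy_part :: "'b measure \<Rightarrow> ('b \<Rightarrow> 'b) \<Rightarrow> 'b set set \<Rightarrow> real" where
  "ks_entropy_part Q S P = lim (\<lambda>n. part_entropy Q (iter_join Q S P (Suc n)) / real (Suc n))"

definition ks_entropy :: "'b measure \<Rightarrow> ('b \<Rightarrow> 'b) \<Rightarrow> ennreal" where
  "ks_entropy Q S = (SUP P\<in>{P. fin_partition Q P}. ennreal (ks_entropy_part Q S P))"

text \<open>H_mu(C | D) for a sub-sigma-algebra C and a sigma-finite sub-sigma-algebra D:
  the conditional probabilities mu_x(A) are given by the conditional expectation of
  the indicator of A w.r.t. D, and the entropy of C is the supremum over finite
  C-measurable partitions.\<close>
definition cond_entropy :: "'a measure \<Rightarrow> 'a measure \<Rightarrow> 'a measure \<Rightarrow> ennreal" where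
  "cond_entropy M C D =
     (SUP P\<in>{P. finite P \<and> P \<subseteq> sets C \<and> disjoint P \<and> \<Union>P = space M}.
        \<integral>\<^sup>+ x. ennreal (\<Sum>A\<in>P. - enn2real (nn_cond_exp M D (indicator A) x)
                              * ln (enn2real (nn_cond_exp M D (indicator A) x))) \<partial>M)"

definition parry_entropy :: "'a measure \<Rightarrow> ('a \<Rightarrow> 'a) \<Rightarrow> ennreal" where
  "parry_entropy M T =
     (SUP C\<in>{C. sigma_finite_subalgebra M C \<and> sets (vimage_algebra (space M) T C) \<subseteq> sets C}.
        cond_entropy M C (vimage_algebra (space M) T C))"

end

(* Proof idea.  Put D = T^-1 C and fix a finite partition Q of X into sets of C.  A conservative
   system without invariant sets of positive finite measure has no atoms in C, hence none in D, so a
   set E of D of finite measure splits into tiny pieces E_j in D on which all conditional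
   probabilities mu(B | D), B in Q, are nearly constant.  Observe, for each j, whether E_j contains
   exactly one point of the Poisson process and, if so, which B in Q that point lies in.  Given the
   counts of all sets G with G Int E_j in D, the single point of E_j has label B with conditional
   probability close to the value of mu(B | D) on E_j; as the T_*-images of the observation only
   involve sets of D, each time step of the itinerary contributes at least about the integral of
   H(Q | D) over E.  Working with finitely many counts at a time keeps everything at the level of
   countable sums of products of Poisson weights. *)

theory Submission
  imports Defs
begin

section \<open>Entropy of itineraries\<close>

text \<open>Asking for exactly one point makes labels computable: under that event the point is
  distributed like \<open>M\<close> normalised on the piece. The price is the probability
  \<open>measure M E * exp (- measure M E)\<close> in place of \<open>measure M E\<close>, so the
  pieces must be tiny; conservativity and the lack of finite invariant sets enter only through this,
  by excluding atoms.

  The condition that merely the trace \<open>G \<inter> E\<close> lies in \<open>D\<close> is forced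
  by treating the pieces one after the other: labels read on earlier pieces involve sets outside
  \<open>D\<close>, but these sets miss the current piece, so the gains of all pieces add up.

  An infinite future is never conditioned on: the gain is proved for each finite itinerary with a
  bound that does not depend on its length. Likewise, invariance of the Poisson law is proved only
  for observations made of finitely many counts of sets of finite measure, where it is an equality
  of products of Poisson weights. Since \<open>ks_entropy_part\<close> is a \<open>lim\<close>,
  convergence must be established before a lower bound on the quotients says anything about
  it.\<close>

lemma fekete_convergent:
  fixes a :: "nat \<Rightarrow> real"
  assumes sub: "\<And>m n. a (m + n) \<le> a m + a n" and nonneg: "\<And>n. 0 \<le> a n"
  shows "convergent (\<lambda>n. a (Suc n) / real (Suc n))"
proof -
  \<comment> \<open>By subadditivity the quotients converge to their infimum. The shift to
    \<open>Suc n\<close> matches \<open>ks_entropy_part\<close> and keeps the denominator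
    positive.\<close>
  define L where "L = (INF n. a (Suc n) / real (Suc n))"
  have bdd: "bdd_below (range (\<lambda>n. a (Suc n) / real (Suc n)))"
    by (rule bdd_belowI[of _ 0]) (auto simp: nonneg)
  have "(\<lambda>n. a (Suc n) / real (Suc n)) \<longlonglongrightarrow> L"
  proof (rule order_tendstoI)
    fix y assume "y < L"
    then show "\<forall>\<^sub>F n in sequentially. y < a (Suc n) / real (Suc n)"
      using cINF_lower[OF bdd] unfolding L_def by (intro always_eventually) (auto intro: less_le_trans)
  next
    fix y assume "L < y"
    then obtain k where k: "a (Suc k) / real (Suc k) < y"
      unfolding L_def using cINF_less_iff[OF _ bdd] by auto
    define m where "m = Suc k"
    have m: "a m / real m < y" "m > 0" using k by (auto simp: m_def)
    define K where "K = Max (a ` {..m})"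
    have K: "a r \<le> K" if "r \<le> m" for r using that unfolding K_def by (intro Max_ge) auto
    have mult: "a (q * m + r) \<le> real q * a m + a r" for q r
    proof (induction q)
      case (Suc q)
      have "a (Suc q * m + r) = a (m + (q * m + r))" by (simp add: algebra_simps)
      also have "\<dots> \<le> a m + a (q * m + r)" by (rule sub)
      finally show ?case using Suc by (simp add: algebra_simps)
    qed simp
    \<comment> \<open>Division of \<open>Suc n\<close> by \<open>m\<close> with remainder: the full
      blocks cost at most \<open>a m / m\<close> per unit, and the remainder costs a constant that
      vanishes after division.\<close>
    have bound: "a (Suc n) / real (Suc n) \<le> a m / real m + K / real (Suc n)" for n
    proof -
      define q r where "q = Suc n div m" and "r = Suc n mod m"
      have n: "Suc n = q * m + r" and r: "r \<le> m"
        using m(2) by (auto simp: q_def r_def intro: less_imp_le)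
      have "real q * m \<le> real (Suc n)" unfolding n by simp
      then have "real q * a m \<le> real (Suc n) * (a m / real m)"
        using m(2) mult_right_mono[of "real q * m" "real (Suc n)" "a m / real m"] nonneg[of m] by simp
      then have "a (Suc n) \<le> real (Suc n) * (a m / real m) + K"
        using mult[of q r] K[OF r] unfolding n[symmetric] by linarith
      then have "a (Suc n) / real (Suc n) \<le> (real (Suc n) * (a m / real m) + K) / real (Suc n)"
        by (intro divide_right_mono) auto
      then show ?thesis by (simp add: add_divide_distrib del: of_nat_Suc)
    qed
    have "(\<lambda>n. a m / real m + K / real (Suc n)) \<longlonglongrightarrow> a m / real m + 0"
      by (intro tendsto_intros LIMSEQ_Suc[OF lim_const_over_n])
    then have "\<forall>\<^sub>F n in sequentially. a m / real m + K / real (Suc n) < y"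
      using m(1) by (auto dest: order_tendstoD(2))
    then show "\<forall>\<^sub>F n in sequentially. a (Suc n) / real (Suc n) < y"
      by eventually_elim (rule le_less_trans[OF bound])
  qed
  then show ?thesis by (rule convergentI)
qed

section \<open>The function -x ln x on the unit interval\<close>

definition neg_xlnx :: "real \<Rightarrow> real" where
  "neg_xlnx x = - x * ln x"

lemma neg_xlnx_0 [simp]: "neg_xlnx 0 = 0"
  by (simp add: neg_xlnx_def)

lemma neg_xlnx_nonneg: "0 \<le> x \<Longrightarrow> x \<le> 1 \<Longrightarrow> 0 \<le> neg_xlnx x"
  by (cases "x = 0") (auto simp: neg_xlnx_def mult_nonneg_nonpos)

lemma neg_xlnx_le_1: "0 \<le> x \<Longrightarrow> x \<le> 1 \<Longrightarrow> neg_xlnx x \<le> 1"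
proof (cases "x = 0")
  case False
  assume "0 \<le> x" "x \<le> 1"
  with False have x: "x > 0" by simp
  have "ln (1 / x) \<le> 1 / x - 1" using x by (intro ln_le_minus_one) auto
  then have "x * - ln x \<le> x * (1 / x - 1)"
    using x by (intro mult_left_mono) (auto simp: ln_div)
  then show ?thesis using x by (simp add: neg_xlnx_def algebra_simps)
qed simp

lemma neg_xlnx_measurable [measurable]: "neg_xlnx \<in> borel_measurable borel"
  unfolding neg_xlnx_def by measurable

lemma neg_xlnx_uniformly_continuous: "uniformly_continuous_on {0..1} neg_xlnx"
proof (rule compact_uniformly_continuous)
  have "(neg_xlnx \<longlongrightarrow> 0) (at_right 0)"
    unfolding neg_xlnx_def by real_asymp
  then have "continuous (at 0 within {0..1}) neg_xlnx"
    unfolding continuous_within by (simp add: at_within_Icc_at_right)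
  moreover have "continuous (at x within {0..1}) neg_xlnx" if "x > 0" for x
    using that unfolding neg_xlnx_def by (intro continuous_intros) auto
  ultimately show "continuous_on {0..1} neg_xlnx"
    unfolding continuous_on_eq_continuous_within by (metis atLeastAtMost_iff order_le_less)
qed simp

text \<open>The modulus is a reciprocal because conditional probabilities will be rounded down to
  multiples of \<open>1 / N\<close>.\<close>

lemma neg_xlnx_modulus:
  assumes "e > 0"
  obtains N :: nat where "N > 0"
    "\<And>x y. x \<in> {0..1} \<Longrightarrow> y \<in> {0..1} \<Longrightarrow> \<bar>x - y\<bar> \<le> 1 / N \<Longrightarrow> \<bar>neg_xlnx x - neg_xlnx y\<bar> \<le> e"
proof -
  obtain d where d: "d > 0"
    "\<And>x y. x \<in> {0..1} \<Longrightarrow> y \<in> {0..1} \<Longrightarrow> dist x y < d \<Longrightarrow> dist (neg_xlnx x) (neg_xlnx y) < e"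
    using neg_xlnx_uniformly_continuous assms unfolding uniformly_continuous_on_def by metis
  obtain N :: nat where N: "N > 0" "1 / N < d"
    using d(1) nat_approx_posE[of d] by (metis zero_less_Suc)
  show thesis
    by (rule that[OF N(1)]) (use d(2) N(2) in \<open>auto simp: dist_real_def intro!: less_imp_le\<close>)
qed

section \<open>Shannon entropy of finite-valued maps\<close>

definition ent :: "'b measure \<Rightarrow> ('b \<Rightarrow> 'c) \<Rightarrow> real" where
  "ent Q X = (\<Sum>v\<in>X ` space Q. neg_xlnx (measure Q (X -` {v} \<inter> space Q)))"

text \<open>Values that are not attained have empty fibres and contribute
  \<open>neg_xlnx 0 = 0\<close>, so a range may be replaced by any finite set containing it, such as
  a product.\<close>

lemma ent_superset:
  assumes "finite V" "X ` space Q \<subseteq> V"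
  shows "ent Q X = (\<Sum>v\<in>V. neg_xlnx (measure Q (X -` {v} \<inter> space Q)))"
  unfolding ent_def
proof (rule sum.mono_neutral_left[OF assms], safe)
  fix v assume "v \<notin> X ` space Q"
  then have "X -` {v} \<inter> space Q = {}" by auto
  then show "neg_xlnx (measure Q (X -` {v} \<inter> space Q)) = 0" by simp
qed

context prob_space
begin

text \<open>Base \<open>exp 1\<close> turns the \<open>log\<close> of the library's entropy into the
  \<open>ln\<close> of \<open>part_entropy\<close>.\<close>

lemma information_space_exp_1: "information_space M (exp 1)"
  by standard auto

lemma ent_eq_entropy:
  assumes "simple_function M X"
  shows "ent M X = entropy (exp 1) (count_space (X ` space M)) X"
proof -
  interpret information_space M "exp 1" by (rule information_space_exp_1)
  show ?thesis
    using entropy_simple_distributed[OF simple_distributedI[OF assms measure_nonneg refl]]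
    by (simp add: ent_def neg_xlnx_def sum_negf log_def)
qed

lemma ent_nonneg: "0 \<le> ent M X"
  unfolding ent_def by (intro sum_nonneg neg_xlnx_nonneg) auto

text \<open>Data processing. It is mostly used to rearrange observations: whatever can be computed
  from \<open>X\<close>, such as head and tail of a list, has at most its entropy.\<close>

lemma ent_compose_le:
  assumes "simple_function M X" "\<And>x. x \<in> space M \<Longrightarrow> Y x = f (X x)"
  shows "ent M Y \<le> ent M X"
proof -
  interpret information_space M "exp 1" by (rule information_space_exp_1)
  have sf: "simple_function M (f \<circ> X)" using assms by auto
  have "ent M Y = ent M (f \<circ> X)"
    unfolding ent_def using assms(2)
    by (intro sum.cong arg_cong[where f = neg_xlnx] arg_cong[where f = "measure M"]) auto
  then show ?thesis
    using entropy_data_processing[OF assms(1), of f]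
    by (simp add: ent_eq_entropy[OF sf] ent_eq_entropy[OF assms(1)])
qed

text \<open>Chain rule, together with the fact that conditioning does not increase entropy.\<close>

lemma ent_Pair_le:
  assumes "simple_function M X" "simple_function M Y"
  shows "ent M (\<lambda>x. (X x, Y x)) \<le> ent M X + ent M Y"
proof -
  interpret information_space M "exp 1" by (rule information_space_exp_1)
  have sf: "simple_function M (\<lambda>x. (X x, Y x))" using assms by (rule simple_function_Pair)
  show ?thesis
    using entropy_chain_rule[OF assms] conditional_entropy_less_eq_entropy[OF assms(2,1)]
    by (simp add: ent_eq_entropy[OF sf] ent_eq_entropy[OF assms(1)] ent_eq_entropy[OF assms(2)])
qed

end

section \<open>Joins of partitions as fibres of itineraries\<close>

definition fibres :: "'b measure \<Rightarrow> ('b \<Rightarrow> 'c) \<Rightarrow> 'b set set" where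
  "fibres Q X = (\<lambda>v. X -` {v} \<inter> space Q) ` X ` space Q"

lemma inj_on_fibre: "inj_on (\<lambda>v. X -` {v} \<inter> space Q) (X ` space Q)"
  by (auto simp: inj_on_def)

lemma fin_partition_fibres:
  assumes "simple_function Q X"
  shows "fin_partition Q (fibres Q X)"
  using assms unfolding fin_partition_def fibres_def simple_function_def
  by (auto simp: disjoint_def)

definition itinerary :: "('b \<Rightarrow> 'b) \<Rightarrow> ('b \<Rightarrow> 'c) \<Rightarrow> nat \<Rightarrow> 'b \<Rightarrow> 'c list" where
  "itinerary S X n = (\<lambda>x. map (\<lambda>i. X ((S ^^ i) x)) [0..<n])"

lemma itinerary_Suc: "itinerary S X (Suc n) x = X x # itinerary S X n (S x)"
  unfolding itinerary_def upt_conv_Cons[OF zero_less_Suc] map_Suc_upt[symmetric]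
  by (simp add: funpow_swap1 del: upt_Suc)

lemma itinerary_add: "itinerary S X (n + m) x = itinerary S X n x @ itinerary S X m ((S ^^ n) x)"
  by (induction n arbitrary: x) (simp_all add: itinerary_Suc funpow_swap1, simp add: itinerary_def)

text \<open>A choice of one block for each time either describes the fibre of an actual itinerary or
  is contradictory and yields \<open>{}\<close>. Hence the join may contain \<open>{}\<close>, which
  is never a fibre but has no effect on the entropy.\<close>

lemma iter_join_fibres:
  assumes S: "S \<in> space Q \<rightarrow> space Q"
  shows "fibres Q (itinerary S X n) \<subseteq> iter_join Q S (fibres Q X) n"
    and "iter_join Q S (fibres Q X) n \<subseteq> insert {} (fibres Q (itinerary S X n))"
proof -
  have Si: "(S ^^ i) x \<in> space Q" if "x \<in> space Q" for i x
    using that S by (induction i) auto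
  show "fibres Q (itinerary S X n) \<subseteq> iter_join Q S (fibres Q X) n"
  proof
    fix A assume "A \<in> fibres Q (itinerary S X n)"
    then obtain x where x: "x \<in> space Q"
      and A: "A = itinerary S X n -` {itinerary S X n x} \<inter> space Q" unfolding fibres_def by auto
    define f where "f i = X -` {X ((S ^^ i) x)} \<inter> space Q" for i
    have "A = space Q \<inter> (\<Inter>i<n. (S ^^ i) -` f i)"
      unfolding A f_def itinerary_def using Si by auto
    moreover have "\<forall>i<n. f i \<in> fibres Q X" unfolding f_def fibres_def using Si x by auto
    ultimately show "A \<in> iter_join Q S (fibres Q X) n" unfolding iter_join_def by blast
  qed
  show "iter_join Q S (fibres Q X) n \<subseteq> insert {} (fibres Q (itinerary S X n))"
  proof
    fix A assume "A \<in> iter_join Q S (fibres Q X) n"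
    then obtain f where A: "A = space Q \<inter> (\<Inter>i<n. (S ^^ i) -` f i)" and f: "\<forall>i<n. f i \<in> fibres Q X"
      unfolding iter_join_def by auto
    show "A \<in> insert {} (fibres Q (itinerary S X n))"
    proof (cases "A = {}")
      case False
      then obtain x where x: "x \<in> A" by auto
      have "f i = X -` {X ((S ^^ i) x)} \<inter> space Q" if "i < n" for i
      proof -
        have "(S ^^ i) x \<in> f i" using x that unfolding A by auto
        then show ?thesis using f[rule_format, OF that] unfolding fibres_def by auto
      qed
      then have "A = itinerary S X n -` {itinerary S X n x} \<inter> space Q"
        unfolding A itinerary_def using Si by auto
      then show ?thesis unfolding fibres_def using x A by auto
    qed simp
  qed
qed

lemma part_entropy_iter_join:
  assumes S: "S \<in> space Q \<rightarrow> space Q" and sf: "simple_function Q (itinerary S X n)"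
  shows "part_entropy Q (iter_join Q S (fibres Q X) n) = ent Q (itinerary S X n)"
proof -
  let ?Y = "itinerary S X n"
  have fin: "finite (fibres Q ?Y)" using sf by (simp add: fibres_def simple_function_def)
  have "part_entropy Q (iter_join Q S (fibres Q X) n) = (\<Sum>A\<in>fibres Q ?Y. neg_xlnx (measure Q A))"
    unfolding part_entropy_def neg_xlnx_def
    using iter_join_fibres[OF S, of X n] finite_subset[OF iter_join_fibres(2)[OF S, of X n]] fin
    by (intro sum.mono_neutral_right) auto
  also have "\<dots> = ent Q ?Y"
    unfolding fibres_def ent_def by (subst sum.reindex[OF inj_on_fibre]) simp
  finally show ?thesis .
qed

lemma simple_function_itinerary:
  assumes "\<And>i. simple_function Q (\<lambda>x. X ((S ^^ i) x))"
  shows "simple_function Q (\<lambda>x. itinerary S X n ((S ^^ m) x))"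
proof (induction n)
  case (Suc n)
  have "simple_function Q (\<lambda>x. itinerary S X n ((S ^^ m) x) @ [X ((S ^^ (n + m)) x)])"
    using Suc assms by (rule simple_function_compose2)
  then show ?case by (simp add: itinerary_def funpow_add)
qed (simp add: itinerary_def)

text \<open>The gain hypothesis bounds from below the conditional entropy of \<open>X\<close> given
  its future, uniformly in the length of the future.\<close>

lemma ks_entropy_ge:
  fixes X :: "'b \<Rightarrow> 'c"
  assumes "prob_space Q" and S: "S \<in> space Q \<rightarrow> space Q"
    and sf: "\<And>i. simple_function Q (\<lambda>x. X ((S ^^ i) x))"
    and stat: "\<And>n m. ent Q (\<lambda>x. itinerary S X n ((S ^^ m) x)) = ent Q (itinerary S X n)"
    and gain: "\<And>n. ent Q (\<lambda>x. itinerary S X n (S x)) + c \<le> ent Q (\<lambda>x. (X x, itinerary S X n (S x)))"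
  shows "ennreal c \<le> ks_entropy Q S"
proof -
  interpret prob_space Q by fact
  define a where "a n = ent Q (itinerary S X n)" for n
  have sfI: "simple_function Q (\<lambda>x. itinerary S X n ((S ^^ m) x))" for n m
    using sf by (rule simple_function_itinerary)
  have sfI0: "simple_function Q (itinerary S X n)" for n using sfI[of n 0] by simp
  \<comment> \<open>Subadditivity serves to show that the \<open>lim\<close> in
    \<open>ks_entropy_part\<close> is a genuine limit.\<close>
  have "a (n + m) \<le> a n + a m" for n m
  proof -
    have "a (n + m) \<le> ent Q (\<lambda>x. (itinerary S X n x, itinerary S X m ((S ^^ n) x)))"
      unfolding a_def
      by (rule ent_compose_le[where f = "\<lambda>(u, v). u @ v"])
        (use sfI sfI0 in \<open>auto intro!: simple_function_Pair simp: itinerary_add\<close>)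
    also have "\<dots> \<le> a n + a m"
      unfolding a_def stat[of m n, symmetric] by (rule ent_Pair_le[OF sfI0 sfI])
    finally show ?thesis .
  qed
  then have conv: "convergent (\<lambda>n. a (Suc n) / real (Suc n))"
    by (rule fekete_convergent) (simp add: a_def ent_nonneg)
  \<comment> \<open>Stationarity with \<open>m = 1\<close> replaces the shifted itinerary by the
    unshifted one; the pair in the gain hypothesis is head and tail of an itinerary of length
    \<open>Suc n\<close>.\<close>
  have step: "a n + c \<le> a (Suc n)" for n
  proof -
    have "a n + c \<le> ent Q (\<lambda>x. (X x, itinerary S X n (S x)))"
      using gain[of n] stat[of n 1] by (simp add: a_def)
    also have "\<dots> \<le> a (Suc n)"
      unfolding a_def
      by (rule ent_compose_le[where f = "\<lambda>u. (hd u, tl u)", OF sfI0]) (simp add: itinerary_Suc)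
    finally show ?thesis .
  qed
  have lin: "real n * c \<le> a n" for n
  proof (induction n)
    case 0
    show ?case by (simp add: a_def ent_nonneg)
  next
    case (Suc n)
    then show ?case using step[of n] by (simp add: algebra_simps)
  qed
  have "c \<le> lim (\<lambda>n. a (Suc n) / real (Suc n))"
  proof (rule Lim_bounded2[OF conv[unfolded convergent_LIMSEQ_iff]])
    show "\<forall>n\<ge>0. c \<le> a (Suc n) / real (Suc n)"
      using lin by (auto simp: field_simps simp del: of_nat_Suc)
  qed
  also have "\<dots> = ks_entropy_part Q S (fibres Q X)"
    unfolding ks_entropy_part_def a_def by (simp add: part_entropy_iter_join[OF S sfI0])
  finally have "ennreal c \<le> ennreal (ks_entropy_part Q S (fibres Q X))" by (rule ennreal_leI)
  also have "\<dots> \<le> ks_entropy Q S"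
    unfolding ks_entropy_def using fin_partition_fibres[of Q X] sf[of 0] by (intro SUP_upper) simp
  finally show ?thesis .
qed

section \<open>Counts of a Poisson process\<close>

definition pois :: "real \<Rightarrow> nat \<Rightarrow> real" where
  "pois x k = exp (- x) * x ^ k / fact k"

lemma pois_nonneg: "0 \<le> x \<Longrightarrow> 0 \<le> pois x k"
  by (simp add: pois_def)

lemma pois_sums: "pois x sums 1"
proof -
  have "(\<lambda>k. exp (- x) * (x ^ k / fact k)) sums (exp (- x) * exp x)"
    using exp_converges[of x] by (intro sums_mult) (simp add: field_simps)
  then show ?thesis by (simp add: pois_def[abs_def] exp_minus)
qed

text \<open>A pointwise substitute for measurability with respect to the counts of \<open>F\<close>,
  independent of any sigma-algebra on the target. For finite \<open>F\<close> within
  \<open>sets M\<close> it implies measurability of all preimages.\<close>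

definition determined :: "('a set \<Rightarrow> ennreal) measure \<Rightarrow> 'a set set \<Rightarrow> (('a set \<Rightarrow> ennreal) \<Rightarrow> 'c) \<Rightarrow> bool" where
  "determined P F Y \<longleftrightarrow>
     (\<forall>\<gamma>\<in>space P. \<forall>\<gamma>'\<in>space P. (\<forall>B\<in>F. \<gamma> B = \<gamma>' B) \<longrightarrow> Y \<gamma> = Y \<gamma>')"

lemma determinedD:
  "determined P F Y \<Longrightarrow> \<gamma> \<in> space P \<Longrightarrow> \<gamma>' \<in> space P \<Longrightarrow> (\<And>B. B \<in> F \<Longrightarrow> \<gamma> B = \<gamma>' B) \<Longrightarrow> Y \<gamma> = Y \<gamma>'"
  unfolding determined_def by blast

lemma determined_mono: "determined P F Y \<Longrightarrow> F \<subseteq> G \<Longrightarrow> determined P G Y"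
  unfolding determined_def by blast

lemma determined_Pair:
  "determined P F Y \<Longrightarrow> determined P G Z \<Longrightarrow> determined P (F \<union> G) (\<lambda>x. (Y x, Z x))"
  unfolding determined_def by blast

text \<open>For \<open>S \<subseteq> F\<close> this is an atom of the algebra generated by
  \<open>F\<close>, coded by the members of \<open>F\<close> that contain it.\<close>

definition cell :: "'a set set \<Rightarrow> 'a set set \<Rightarrow> 'a set" where
  "cell F S = \<Inter>S - \<Union>(F - S)"

text \<open>The index \<open>{}\<close> is left out: its cell would be the complement of
  \<open>\<Union>F\<close>, whose measure may be infinite and which meets no member of
  \<open>F\<close>.\<close>

definition cells :: "'a set set \<Rightarrow> 'a set set set" where
  "cells F = Pow F - {{}}"

lemma finite_cells: "finite F \<Longrightarrow> finite (cells F)"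
  by (simp add: cells_def)

text \<open>A set that belongs to just one of two index sets contains the one cell and misses the
  other.\<close>

lemma disjoint_cells: "disjoint_family_on (cell F) (cells F)"
  unfolding disjoint_family_on_def
proof (intro ballI impI)
  fix S S' assume "S \<in> cells F" "S' \<in> cells F" "S \<noteq> S'"
  then have "(\<exists>A. A \<in> S \<and> A \<in> F - S') \<or> (\<exists>A. A \<in> S' \<and> A \<in> F - S)" unfolding cells_def by blast
  then show "cell F S \<inter> cell F S' = {}" unfolding cell_def by blast
qed

lemma UN_cells:
  assumes "B \<in> F"
  shows "(\<Union>S\<in>{S \<in> cells F. B \<in> S}. cell F S) = B"
proof (intro equalityI subsetI)
  fix x assume "x \<in> B"
  then have "{A \<in> F. x \<in> A} \<in> {S \<in> cells F. B \<in> S}" "x \<in> cell F {A \<in> F. x \<in> A}"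
    using assms by (auto simp: cells_def cell_def)
  then show "x \<in> (\<Union>S\<in>{S \<in> cells F. B \<in> S}. cell F S)" by blast
qed (auto simp: cell_def)

lemma sets_cell:
  assumes "finite F" "F \<subseteq> sets M" "S \<in> cells F"
  shows "cell F S \<in> sets M"
proof -
  have S: "finite S" "S \<noteq> {}" "S \<subseteq> sets M"
    using assms by (auto simp: cells_def intro: finite_subset)
  have "(\<Inter>A\<in>S. A) \<in> sets M" using S by (intro sets.finite_INT) auto
  moreover have "\<Union>(F - S) \<in> sets M" using assms by (intro sets.finite_Union) auto
  ultimately show ?thesis unfolding cell_def by auto
qed

locale poisson_process =
  fixes M :: "'a measure" and P :: "('a set \<Rightarrow> ennreal) measure"
  assumes poisson: "is_poisson_measure M P"
begin

sublocale prob_space P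
  using poisson by (simp add: is_poisson_measure_def)

lemma space_P: "space P = counting_measures M"
proof -
  have "space P = space (poisson_space M)"
    using poisson by (intro sets_eq_imp_space_eq) (simp add: is_poisson_measure_def)
  also have "\<dots> = counting_measures M"
    unfolding poisson_space_def by (rule space_measure_of) auto
  finally show ?thesis .
qed

lemma measurable_count [measurable]:
  assumes "B \<in> sets M"
  shows "(\<lambda>\<gamma>. \<gamma> B) \<in> borel_measurable P"
proof (rule measurableI)
  fix S :: "ennreal set" assume "S \<in> sets borel"
  then have "{\<gamma> \<in> counting_measures M. \<gamma> B \<in> S} \<in> sets (poisson_space M)"
    unfolding poisson_space_def using assms
    by (subst sets_measure_of) (auto intro!: sigma_sets.Basic)
  moreover have "(\<lambda>\<gamma>. \<gamma> B) -` S \<inter> space P = {\<gamma> \<in> counting_measures M. \<gamma> B \<in> S}"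
    by (auto simp: space_P)
  ultimately show "(\<lambda>\<gamma>. \<gamma> B) -` S \<inter> space P \<in> sets P"
    using poisson by (simp add: is_poisson_measure_def)
qed simp

text \<open>A configuration is a bare set function; rebuilding a measure from it gives access to the
  general lemmas on additivity and monotonicity.\<close>

definition as_measure :: "('a set \<Rightarrow> ennreal) \<Rightarrow> 'a measure" where
  "as_measure \<gamma> = measure_of (space M) (sets M) \<gamma>"

lemma sets_as_measure [simp]: "sets (as_measure \<gamma>) = sets M"
  by (simp add: as_measure_def)

lemma emeasure_as_measure:
  assumes "\<gamma> \<in> space P" "B \<in> sets M"
  shows "emeasure (as_measure \<gamma>) B = \<gamma> B"
  using assms sets.sigma_sets_eq[of M] unfolding as_measure_def
  by (auto simp: space_P counting_measures_def emeasure_measure_of_conv)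

lemma count_UN:
  assumes "\<gamma> \<in> space P" "finite I" "\<And>i. i \<in> I \<Longrightarrow> g i \<in> sets M" "disjoint_family_on g I"
  shows "\<gamma> (\<Union>i\<in>I. g i) = (\<Sum>i\<in>I. \<gamma> (g i))"
proof -
  have "(\<Sum>i\<in>I. emeasure (as_measure \<gamma>) (g i)) = emeasure (as_measure \<gamma>) (\<Union>i\<in>I. g i)"
    using assms by (intro sum_emeasure) auto
  then show ?thesis using assms by (simp add: emeasure_as_measure sets.finite_UN)
qed

lemma count_split:
  assumes "\<gamma> \<in> space P" "A \<in> sets M" "B \<in> sets M"
  shows "\<gamma> A = \<gamma> (A \<inter> B) + \<gamma> (A - B)"
proof -
  have "emeasure (as_measure \<gamma>) (A \<inter> B) + emeasure (as_measure \<gamma>) (A - B)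
      = emeasure (as_measure \<gamma>) ((A \<inter> B) \<union> (A - B))"
    using assms by (intro plus_emeasure) auto
  then show ?thesis using assms by (simp add: emeasure_as_measure Int_Diff_Un)
qed

lemma count_mono:
  assumes "\<gamma> \<in> space P" "A \<subseteq> B" "A \<in> sets M" "B \<in> sets M"
  shows "\<gamma> A \<le> \<gamma> B"
  using emeasure_mono[of A B "as_measure \<gamma>"] assms by (simp add: emeasure_as_measure)

lemma count_range: "\<gamma> \<in> space P \<Longrightarrow> B \<in> sets M \<Longrightarrow> \<gamma> B \<in> range of_nat \<union> {\<infinity>}"
  by (simp add: space_P counting_measures_def)

definition finsets :: "'a set set" where
  "finsets = {B \<in> sets M. emeasure M B < \<infinity>}"

lemma finsets_sets: "B \<in> finsets \<Longrightarrow> B \<in> sets M"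
  by (simp add: finsets_def)

lemma finsets_subset: "B \<in> finsets \<Longrightarrow> A \<in> sets M \<Longrightarrow> A \<subseteq> B \<Longrightarrow> A \<in> finsets"
  unfolding finsets_def using emeasure_mono[of A B M] by auto

text \<open>The defining product formula, transported from initial segments of the naturals to
  arbitrary finite index sets, since cells are indexed by sets of sets.\<close>

lemma cylinder:
  assumes I: "finite I" and g: "\<And>i. i \<in> I \<Longrightarrow> g i \<in> finsets" and disj: "disjoint_family_on g I"
  shows "measure P {\<gamma> \<in> space P. \<forall>i\<in>I. \<gamma> (g i) = of_nat (k i)} = (\<Prod>i\<in>I. pois (measure M (g i)) (k i))"
proof -
  obtain h where h: "bij_betw h {0..<card I} I" using ex_bij_betw_nat_finite[OF I] by blast
  then have hI: "h i \<in> I" if "i < card I" for i using that by (auto simp: bij_betw_def)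
  have "disjoint_family_on (g \<circ> h) {..<card I}"
    unfolding disjoint_family_on_def
  proof (intro ballI impI)
    fix m n assume mn: "m \<in> {..<card I}" "n \<in> {..<card I}" "m \<noteq> n"
    then have "h m \<noteq> h n" using h by (auto simp: bij_betw_def inj_on_def)
    then show "(g \<circ> h) m \<inter> (g \<circ> h) n = {}"
      using disj hI mn by (auto simp: disjoint_family_on_def)
  qed
  moreover have "(g \<circ> h) i \<in> sets M \<and> emeasure M ((g \<circ> h) i) < \<infinity>" if "i < card I" for i
    using g[OF hI[OF that]] by (simp add: finsets_def)
  ultimately have "measure P {\<gamma> \<in> space P. \<forall>i<card I. \<gamma> ((g \<circ> h) i) = of_nat ((k \<circ> h) i)} =
      (\<Prod>i<card I. exp (- measure M ((g \<circ> h) i)) * measure M ((g \<circ> h) i) ^ (k \<circ> h) i / fact ((k \<circ> h) i))"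
    using poisson[unfolded is_poisson_measure_def, THEN conjunct2, THEN conjunct2, THEN conjunct1,
        rule_format, of "card I" "g \<circ> h" "k \<circ> h"] by blast
  also have "\<dots> = (\<Prod>i\<in>{0..<card I}. pois (measure M (g (h i))) (k (h i)))"
    by (simp add: pois_def lessThan_atLeast0)
  also have "\<dots> = (\<Prod>i\<in>I. pois (measure M (g i)) (k i))"
    by (rule prod.reindex_bij_betw[OF h])
  also have "{\<gamma> \<in> space P. \<forall>i<card I. \<gamma> ((g \<circ> h) i) = of_nat ((k \<circ> h) i)}
      = {\<gamma> \<in> space P. \<forall>i\<in>I. \<gamma> (g i) = of_nat (k i)}"
  proof -
    have "\<exists>j<card I. i = h j" if "i \<in> I" for i
    proof -
      have "i \<in> h ` {0..<card I}" using h that by (simp add: bij_betw_def)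
      then show ?thesis by auto
    qed
    then have "(\<forall>i<card I. Q (h i)) \<longleftrightarrow> (\<forall>i\<in>I. Q i)" for Q
      using hI by blast
    then have "(\<forall>i<card I. \<gamma> ((g \<circ> h) i) = of_nat ((k \<circ> h) i)) \<longleftrightarrow> (\<forall>i\<in>I. \<gamma> (g i) = of_nat (k i))"
      for \<gamma> :: "'a set \<Rightarrow> ennreal"
      unfolding comp_apply .
    then show ?thesis by (intro Collect_cong conj_cong refl)
  qed
  finally show ?thesis .
qed

lemma count_eq:
  assumes "B \<in> finsets"
  shows "measure P {\<gamma> \<in> space P. \<gamma> B = of_nat k} = pois (measure M B) k"
  using cylinder[of "{()}" "\<lambda>_. B" "\<lambda>_. k"] assms by (simp add: disjoint_family_on_def)

text \<open>The Poisson weights of the finite values already sum to 1, so nothing is left for the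
  value infinity.\<close>

lemma AE_count_finite:
  assumes B: "B \<in> finsets"
  shows "AE \<gamma> in P. \<exists>n. \<gamma> B = of_nat n"
proof -
  have [measurable]: "B \<in> sets M" using B by (rule finsets_sets)
  define A where "A k = {\<gamma> \<in> space P. \<gamma> B = of_nat k}" for k :: nat
  have [measurable]: "A k \<in> sets P" for k unfolding A_def by measurable
  have "disjoint_family A" unfolding A_def disjoint_family_on_def by auto
  then have "(\<lambda>k. measure P (A k)) sums measure P (\<Union>k. A k)"
    by (intro finite_measure_UNION) auto
  moreover have "(\<lambda>k. measure P (A k)) sums 1"
    unfolding A_def count_eq[OF B] by (rule pois_sums)
  ultimately have "prob (\<Union>k. A k) = 1" by (simp add: sums_unique2)
  then have "AE \<gamma> in P. \<gamma> \<in> (\<Union>k. A k)" by (intro prob_eq_1[THEN iffD1]) auto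
  then show ?thesis by eventually_elim (auto simp: A_def)
qed

text \<open>Each count has countably many possible values, so an event determined by finitely many
  counts is a countable union of events that fix all of them. Infinite counts must be included, as
  the equality of sets has to hold everywhere and not just almost surely.\<close>

lemma determined_measurable:
  assumes F: "finite F" "F \<subseteq> sets M" and Y: "determined P F Y"
  shows "Y -` V \<inter> space P \<in> sets P"
proof -
  define C :: "('a set \<Rightarrow> ennreal) set" where "C = PiE F (\<lambda>_. range of_nat \<union> {\<infinity>})"
  define C' where "C' = {c \<in> C. \<exists>\<gamma>\<in>space P. Y \<gamma> \<in> V \<and> (\<forall>B\<in>F. \<gamma> B = c B)}"
  have "countable C'" unfolding C'_def C_def
    using F by (intro countable_subset[OF _ countable_PiE[of F "\<lambda>_. range of_nat \<union> {\<infinity>}"]]) auto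
  moreover have "{\<gamma> \<in> space P. \<forall>B\<in>F. \<gamma> B = c B} \<in> sets P" for c
  proof -
    have "{\<gamma> \<in> space P. \<gamma> B = c B} \<in> sets P" if "B \<in> F" for B
    proof -
      have [measurable]: "B \<in> sets M" using F that by auto
      show ?thesis by measurable
    qed
    then show ?thesis using F(1) by (rule sets.sets_Collect_finite_All)
  qed
  ultimately have "(\<Union>c\<in>C'. {\<gamma> \<in> space P. \<forall>B\<in>F. \<gamma> B = c B}) \<in> sets P"
    by (intro sets.countable_UN') auto
  also have "(\<Union>c\<in>C'. {\<gamma> \<in> space P. \<forall>B\<in>F. \<gamma> B = c B}) = Y -` V \<inter> space P"
  proof (intro equalityI subsetI)
    fix \<gamma> assume "\<gamma> \<in> Y -` V \<inter> space P"
    moreover from this have "restrict \<gamma> F \<in> C'"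
      unfolding C'_def C_def
    proof (intro CollectI conjI)
      show "restrict \<gamma> F \<in> PiE F (\<lambda>_. range of_nat \<union> {\<infinity>})"
        using \<open>\<gamma> \<in> Y -` V \<inter> space P\<close> F(2) by (intro restrict_PiE_iff[THEN iffD2] ballI count_range) auto
      show "\<exists>\<gamma>'\<in>space P. Y \<gamma>' \<in> V \<and> (\<forall>B\<in>F. \<gamma>' B = restrict \<gamma> F B)"
        using \<open>\<gamma> \<in> Y -` V \<inter> space P\<close> by (intro bexI[of _ \<gamma>]) auto
    qed
    ultimately show "\<gamma> \<in> (\<Union>c\<in>C'. {\<gamma> \<in> space P. \<forall>B\<in>F. \<gamma> B = c B})"
      by (intro UN_I[of "restrict \<gamma> F"]) auto
  next
    fix \<gamma> assume "\<gamma> \<in> (\<Union>c\<in>C'. {\<gamma> \<in> space P. \<forall>B\<in>F. \<gamma> B = c B})"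
    then obtain \<gamma>' where "\<gamma> \<in> space P" "\<gamma>' \<in> space P" "Y \<gamma>' \<in> V" "\<forall>B\<in>F. \<gamma> B = \<gamma>' B"
      unfolding C'_def by auto
    then show "\<gamma> \<in> Y -` V \<inter> space P" using determinedD[OF Y, of \<gamma> \<gamma>'] by auto
  qed
  finally show ?thesis .
qed

lemma determined_simple_function:
  assumes "finite F" "F \<subseteq> sets M" "determined P F Y" "finite (Y ` space P)"
  shows "simple_function P Y"
  using assms determined_measurable[OF assms(1-3)] by (simp add: simple_function_def)

text \<open>Only finite counts are prescribed: a configuration with an infinite count on some
  \<open>g i\<close> lies in no cylinder.\<close>

definition cyl :: "'i set \<Rightarrow> ('i \<Rightarrow> 'a set) \<Rightarrow> ('i \<Rightarrow> nat) \<Rightarrow> ('a set \<Rightarrow> ennreal) set" where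
  "cyl I g k = {\<gamma> \<in> space P. \<forall>i\<in>I. \<gamma> (g i) = of_nat (k i)}"

lemma sets_cyl:
  assumes "finite I" "\<And>i. i \<in> I \<Longrightarrow> g i \<in> sets M"
  shows "cyl I g k \<in> sets P"
  unfolding cyl_def
proof (rule sets.sets_Collect_finite_All[OF _ assms(1)])
  fix i assume "i \<in> I"
  then have [measurable]: "g i \<in> sets M" by (rule assms)
  show "{\<gamma> \<in> space P. \<gamma> (g i) = of_nat (k i)} \<in> sets P" by measurable
qed

text \<open>Almost surely all counts are finite, so the cylinders partition the space up to a null
  set; \<open>PiE\<close> makes the count vector of a configuration unique. Identities and
  inequalities between probabilities can then be proved cylinder by cylinder.\<close>

lemma emeasure_decompose:
  assumes I: "finite I" and g: "\<And>i. i \<in> I \<Longrightarrow> g i \<in> finsets" and R: "R \<in> sets P"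
  shows "emeasure P R = (\<integral>\<^sup>+k. emeasure P (R \<inter> cyl I g k) \<partial>count_space (PiE I (\<lambda>_. UNIV)))"
proof -
  let ?K = "PiE I (\<lambda>_. UNIV :: nat set)"
  have cylM: "cyl I g k \<in> sets P" for k using I g finsets_sets by (intro sets_cyl) auto
  have disj: "disjoint_family_on (\<lambda>k. R \<inter> cyl I g k) ?K"
    unfolding disjoint_family_on_def
  proof (intro ballI impI)
    fix k k' assume kk: "k \<in> ?K" "k' \<in> ?K" "k \<noteq> k'"
    then obtain i where "i \<in> I" "k i \<noteq> k' i" by (metis PiE_ext)
    then show "(R \<inter> cyl I g k) \<inter> (R \<inter> cyl I g k') = {}" by (auto simp: cyl_def)
  qed
  have "AE \<gamma> in P. \<forall>i\<in>I. \<exists>n. \<gamma> (g i) = of_nat n"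
    using I AE_count_finite[OF g] by (intro AE_finite_allI) auto
  then have "AE \<gamma> in P. \<gamma> \<in> R \<longleftrightarrow> \<gamma> \<in> (\<Union>k\<in>?K. R \<inter> cyl I g k)"
  proof (rule AE_mp[OF _ AE_I2], intro impI)
    fix \<gamma> assume \<gamma>: "\<gamma> \<in> space P" and "\<forall>i\<in>I. \<exists>n. \<gamma> (g i) = of_nat n"
    then obtain k where "\<And>i. i \<in> I \<Longrightarrow> \<gamma> (g i) = of_nat (k i)" by metis
    then have "restrict k I \<in> ?K" "\<gamma> \<in> cyl I g (restrict k I)" using \<gamma> by (auto simp: cyl_def)
    then show "\<gamma> \<in> R \<longleftrightarrow> \<gamma> \<in> (\<Union>k\<in>?K. R \<inter> cyl I g k)" by blast
  qed
  moreover have "countable ?K" using I by (intro countable_PiE) auto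
  ultimately have "emeasure P R = emeasure P (\<Union>k\<in>?K. R \<inter> cyl I g k)"
    using R cylM by (intro emeasure_eq_AE) (auto intro!: sets.countable_UN')
  also have "\<dots> = (\<integral>\<^sup>+k. emeasure P (R \<inter> cyl I g k) \<partial>count_space ?K)"
    using R cylM disj \<open>countable ?K\<close> by (intro emeasure_UN_countable) auto
  finally show ?thesis .
qed

text \<open>All configurations of a cylinder share the counts that determine \<open>Y\<close>, so
  \<open>Y\<close> is constant there.\<close>

lemma cyl_subset_or_disjoint:
  assumes "determined P (g ` I) Y"
  shows "cyl I g k \<subseteq> Y -` V \<inter> space P \<or> (Y -` V \<inter> space P) \<inter> cyl I g k = {}"
proof (rule disjCI, rule subsetI)
  fix \<gamma> assume \<gamma>: "\<gamma> \<in> cyl I g k" and "(Y -` V \<inter> space P) \<inter> cyl I g k \<noteq> {}"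
  then obtain \<gamma>' where "\<gamma>' \<in> cyl I g k" "Y \<gamma>' \<in> V" by auto
  moreover from this \<gamma> have "Y \<gamma> = Y \<gamma>'"
    by (intro determinedD[OF assms]) (auto simp: cyl_def)
  ultimately show "\<gamma> \<in> Y -` V \<inter> space P"
    using \<gamma> by (auto simp: cyl_def)
qed

text \<open>The product formula needs disjoint sets, whereas members of \<open>F\<close> may
  overlap. Each count on \<open>F\<close> is a sum of counts on cells, so passing to cells loses no
  information.\<close>

lemma determined_cells:
  assumes F: "finite F" "F \<subseteq> sets M" and Y: "determined P F Y"
  shows "determined P (cell F ` cells F) Y"
  unfolding determined_def
proof (intro ballI impI)
  fix \<gamma> \<gamma>' assume \<gamma>: "\<gamma> \<in> space P" "\<gamma>' \<in> space P" and eq: "\<forall>B\<in>cell F ` cells F. \<gamma> B = \<gamma>' B"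
  have "\<gamma> B = \<gamma>' B" if "B \<in> F" for B
  proof -
    have "\<gamma>'' B = (\<Sum>S\<in>{S \<in> cells F. B \<in> S}. \<gamma>'' (cell F S))" if "\<gamma>'' \<in> space P" for \<gamma>''
    proof -
      have "disjoint_family_on (cell F) {S \<in> cells F. B \<in> S}"
        by (rule disjoint_family_on_mono[OF _ disjoint_cells]) auto
      then have "\<gamma>'' (\<Union>S\<in>{S \<in> cells F. B \<in> S}. cell F S) = (\<Sum>S\<in>{S \<in> cells F. B \<in> S}. \<gamma>'' (cell F S))"
        using finite_cells[OF F(1)] sets_cell[OF F] by (intro count_UN[OF that]) auto
      then show ?thesis unfolding UN_cells[OF \<open>B \<in> F\<close>] .
    qed
    moreover have "(\<Sum>S\<in>{S \<in> cells F. B \<in> S}. \<gamma> (cell F S)) = (\<Sum>S\<in>{S \<in> cells F. B \<in> S}. \<gamma>' (cell F S))"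
      using eq by (intro sum.cong) auto
    ultimately show ?thesis using \<gamma> by simp
  qed
  then show "Y \<gamma> = Y \<gamma>'" by (rule determinedD[OF Y \<gamma>])
qed

lemma cell_finsets:
  assumes "finite F" "F \<subseteq> finsets" "S \<in> cells F"
  shows "cell F S \<in> finsets"
proof -
  obtain B where "B \<in> S" "B \<in> F" using assms(3) by (auto simp: cells_def)
  moreover have "cell F S \<in> sets M"
    by (rule sets_cell[OF assms(1) _ assms(3)]) (use assms(2) finsets_sets in blast)
  moreover have "cell F S \<subseteq> B" using \<open>B \<in> S\<close> by (auto simp: cell_def)
  ultimately show ?thesis using assms(2) finsets_subset by blast
qed

end

section \<open>Stationarity and the position of a single point\<close>

lemma measure_preserving_emeasure:
  assumes "measure_preserving M T" "B \<in> sets M"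
  shows "T -` B \<inter> space M \<in> sets M" "emeasure M (T -` B \<inter> space M) = emeasure M B"
proof -
  have T: "T \<in> M \<rightarrow>\<^sub>M M" "distr M M T = M" using assms by (auto simp: measure_preserving_def)
  show "T -` B \<inter> space M \<in> sets M" using T(1) assms(2) by (rule measurable_sets)
  have "emeasure (distr M M T) B = emeasure M (T -` B \<inter> space M)"
    using T(1) assms(2) by (rule emeasure_distr)
  then show "emeasure M (T -` B \<inter> space M) = emeasure M B" using T(2) by simp
qed

context poisson_process
begin

lemma push_counting_space:
  assumes T: "T \<in> M \<rightarrow>\<^sub>M M" and \<gamma>: "\<gamma> \<in> space P"
  shows "push_counting M T \<gamma> \<in> space P"
proof -
  define N where "N = distr (as_measure \<gamma>) M T"
  have sp: "space (as_measure \<gamma>) = space M" by (rule sets_eq_imp_space_eq) simp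
  have T': "T \<in> as_measure \<gamma> \<rightarrow>\<^sub>M M" using T by (simp cong: measurable_cong_sets)
  \<comment> \<open>The pushed configuration is the \<open>emeasure\<close> of an image measure.
    Outside \<open>sets M\<close> both are 0, which is the convention built into
    \<open>counting_measures\<close>.\<close>
  have "emeasure N = push_counting M T \<gamma>"
  proof
    fix B show "emeasure N B = push_counting M T \<gamma> B"
    proof (cases "B \<in> sets M")
      case True
      then show ?thesis
        using emeasure_distr[OF T' True] emeasure_as_measure[OF \<gamma> measurable_sets[OF T True]]
        by (simp add: N_def push_counting_def sp)
    next
      case False
      then show ?thesis by (simp add: emeasure_notin_sets N_def push_counting_def)
    qed
  qed
  then have "measure_space (space M) (sets M) (push_counting M T \<gamma>)"
    using measure_space[of N] by (simp add: N_def)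
  moreover have "push_counting M T \<gamma> B \<in> range of_nat \<union> {\<infinity>}" if "B \<in> sets M" for B
    using count_range[OF \<gamma> measurable_sets[OF T that]] that by (simp add: push_counting_def)
  ultimately show ?thesis
    by (simp add: space_P counting_measures_def) (simp add: push_counting_def)
qed

lemma determined_push:
  assumes T: "T \<in> M \<rightarrow>\<^sub>M M" and F: "F \<subseteq> sets M" and Y: "determined P F Y"
  shows "determined P ((\<lambda>B. T -` B \<inter> space M) ` F) (\<lambda>\<gamma>. Y (push_counting M T \<gamma>))"
  unfolding determined_def
proof (intro ballI impI)
  fix \<gamma> \<gamma>' assume \<gamma>: "\<gamma> \<in> space P" "\<gamma>' \<in> space P"
    and eq: "\<forall>B\<in>(\<lambda>B. T -` B \<inter> space M) ` F. \<gamma> B = \<gamma>' B"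
  then show "Y (push_counting M T \<gamma>) = Y (push_counting M T \<gamma>')"
    using F by (intro determinedD[OF Y] push_counting_space[OF T]) (auto simp: push_counting_def)
qed

text \<open>The push-forward sends configurations with counts \<open>k\<close> on the preimages of
  the cells to configurations with counts \<open>k\<close> on the cells. Both cylinders have the
  same product of Poisson weights because \<open>T\<close> preserves the measure, and summation over
  \<open>k\<close> gives the claim.\<close>

lemma stationary:
  assumes T: "measure_preserving M T"
    and F: "finite F" "F \<subseteq> finsets" and Y: "determined P F Y"
  shows "measure P ((\<lambda>\<gamma>. Y (push_counting M T \<gamma>)) -` V \<inter> space P) = measure P (Y -` V \<inter> space P)"
proof -
  let ?S = "push_counting M T" and ?I = "cells F" and ?g = "cell F"
  let ?h = "\<lambda>S. T -` cell F S \<inter> space M"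
  have TM: "T \<in> M \<rightarrow>\<^sub>M M" using T by (simp add: measure_preserving_def)
  have FM: "F \<subseteq> sets M" using F finsets_sets by auto
  have I: "finite ?I" using F by (intro finite_cells)
  have g: "?g S \<in> finsets" if "S \<in> ?I" for S using F that by (rule cell_finsets)
  have h: "?h S \<in> finsets" if "S \<in> ?I" for S
    using g[OF that] measure_preserving_emeasure[OF T, of "?g S"] by (simp add: finsets_def)
  have disj: "disjoint_family_on ?g ?I" by (rule disjoint_cells)
  then have disjh: "disjoint_family_on ?h ?I" unfolding disjoint_family_on_def by blast
  have Y': "determined P (?g ` ?I) Y" using F(1) FM Y by (rule determined_cells)
  let ?R = "Y -` V \<inter> space P" and ?R' = "(\<lambda>\<gamma>. Y (?S \<gamma>)) -` V \<inter> space P"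
  have R: "?R \<in> sets P" using F(1) FM Y by (rule determined_measurable)
  have R': "?R' \<in> sets P"
    using F(1) FM measure_preserving_emeasure(1)[OF T]
    by (intro determined_measurable[OF _ _ determined_push[OF TM FM Y]]) auto
  have eq: "emeasure P (?R' \<inter> cyl ?I ?h k) = emeasure P (?R \<inter> cyl ?I ?g k)" for k
  proof -
    have mv: "?S \<gamma> \<in> cyl ?I ?g k" if "\<gamma> \<in> cyl ?I ?h k" for \<gamma>
      using that push_counting_space[OF TM, of \<gamma>] g[THEN finsets_sets]
      by (auto simp: cyl_def push_counting_def)
    have "measure P (cyl ?I ?h k) = (\<Prod>S\<in>?I. pois (measure M (?h S)) (k S))"
      unfolding cyl_def using I h disjh by (rule cylinder)
    also have "\<dots> = (\<Prod>S\<in>?I. pois (measure M (?g S)) (k S))"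
      using measure_preserving_emeasure(2)[OF T] g[THEN finsets_sets]
      by (intro prod.cong) (auto simp: measure_def)
    also have "\<dots> = measure P (cyl ?I ?g k)"
      unfolding cyl_def using I g disj by (rule cylinder[symmetric])
    finally have cyl_eq: "measure P (cyl ?I ?h k) = measure P (cyl ?I ?g k)" .
    consider "cyl ?I ?g k \<subseteq> ?R" | "?R \<inter> cyl ?I ?g k = {}"
      using cyl_subset_or_disjoint[OF Y'] by blast
    then show ?thesis
    proof cases
      case 1
      then have "?R \<inter> cyl ?I ?g k = cyl ?I ?g k" "?R' \<inter> cyl ?I ?h k = cyl ?I ?h k"
        using mv by (auto simp: cyl_def)
      then show ?thesis using cyl_eq by (simp add: emeasure_eq_measure)
    next
      case 2
      then have "?R' \<inter> cyl ?I ?h k = {}" using mv by (auto simp: cyl_def)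
      then show ?thesis using 2 by simp
    qed
  qed
  have "emeasure P ?R' = (\<integral>\<^sup>+k. emeasure P (?R' \<inter> cyl ?I ?h k) \<partial>count_space (PiE ?I (\<lambda>_. UNIV)))"
    using I h R' by (rule emeasure_decompose)
  also have "\<dots> = (\<integral>\<^sup>+k. emeasure P (?R \<inter> cyl ?I ?g k) \<partial>count_space (PiE ?I (\<lambda>_. UNIV)))"
    by (simp only: eq)
  also have "\<dots> = emeasure P ?R"
    using I g R by (rule emeasure_decompose[symmetric])
  finally have "emeasure P ?R' = emeasure P ?R" .
  then show ?thesis by (simp add: measure_def)
qed

definition one_point :: "'a set \<Rightarrow> ('a set \<Rightarrow> ennreal) set" where
  "one_point E = {\<gamma> \<in> space P. \<gamma> E = 1}"

definition hit :: "'a set \<Rightarrow> 'a set \<Rightarrow> ('a set \<Rightarrow> ennreal) set" where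
  "hit E B = {\<gamma> \<in> space P. \<gamma> E = 1 \<and> \<gamma> (E \<inter> B) = 1}"

lemma sets_one_point: "E \<in> sets M \<Longrightarrow> one_point E \<in> sets P"
  unfolding one_point_def by measurable

lemma sets_hit: "E \<in> sets M \<Longrightarrow> B \<in> sets M \<Longrightarrow> hit E B \<in> sets P"
proof -
  assume [measurable]: "E \<in> sets M" "B \<in> sets M"
  then have [measurable]: "E \<inter> B \<in> sets M" by (rule sets.Int)
  show ?thesis unfolding hit_def by measurable
qed

lemma measure_one_point: "E \<in> finsets \<Longrightarrow> measure P (one_point E) = measure M E * exp (- measure M E)"
  using count_eq[of E 1] by (simp add: one_point_def pois_def)

text \<open>Among the pieces of \<open>E\<close> exactly one carries the single point, and its
  location inside that piece \<open>g i\<close> is distributed like \<open>M\<close>.\<close>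

lemma hit_cyl:
  assumes I: "finite I" and g: "\<And>i. i \<in> I \<Longrightarrow> g i \<in> finsets" and disj: "disjoint_family_on g I"
    and J: "J \<subseteq> I" and E: "E = (\<Union>i\<in>J. g i)" and B: "B \<in> sets M"
    and a: "\<And>i. i \<in> J \<Longrightarrow> a * measure M (g i) \<le> measure M (g i \<inter> B)"
    and b: "\<And>i. i \<in> J \<Longrightarrow> measure M (g i \<inter> B) \<le> b * measure M (g i)"
  shows "a * measure P (one_point E \<inter> cyl I g k) \<le> measure P (hit E B \<inter> cyl I g k) \<and>
    measure P (hit E B \<inter> cyl I g k) \<le> b * measure P (one_point E \<inter> cyl I g k)"
proof -
  have fJ: "finite J" using I J by (rule rev_finite_subset)
  have gM: "g i \<in> sets M" if "i \<in> I" for i using g[OF that] by (rule finsets_sets)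
  have disjJ: "disjoint_family_on g J" using J disj by (rule disjoint_family_on_mono)
  have cE: "\<gamma> E = of_nat (\<Sum>i\<in>J. k i)" if "\<gamma> \<in> cyl I g k" for \<gamma>
    unfolding E using that J gM count_UN[OF _ fJ _ disjJ, of \<gamma>]
    by (auto simp: cyl_def subset_iff)
  show ?thesis
  proof (cases "(\<Sum>i\<in>J. k i) = 1")
    case False
    then have "\<gamma> E \<noteq> 1" if "\<gamma> \<in> cyl I g k" for \<gamma>
      unfolding cE[OF that] by (simp only: of_nat_eq_1_iff not_False_eq_True)
    then have "one_point E \<inter> cyl I g k = {}" "hit E B \<inter> cyl I g k = {}"
      unfolding one_point_def hit_def by blast+
    then show ?thesis by simp
  next
    case True
    \<comment> \<open>Natural numbers with sum 1: one piece \<open>g i0\<close> holds the point and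
      the other pieces of \<open>E\<close> are empty.\<close>
    then obtain i0 where i0: "i0 \<in> J" "k i0 = 1" "\<And>i. i \<in> J \<Longrightarrow> i \<noteq> i0 \<Longrightarrow> k i = 0"
      using sum_eq_1_iff[OF fJ, of k] by auto
    have iI: "i0 \<in> I" using i0 J by auto
    define C where "C = (\<Prod>i\<in>I - {i0}. pois (measure M (g i)) (k i))"
    have C0: "C \<ge> 0" unfolding C_def by (intro prod_nonneg pois_nonneg) auto
    define e where "e = exp (- measure M (g i0))"
    have "one_point E \<inter> cyl I g k = cyl I g k"
      using cE True by (auto simp: one_point_def cyl_def)
    then have one_point: "measure P (one_point E \<inter> cyl I g k) = measure M (g i0) * (e * C)"
      using cylinder[OF I g disj, of k] i0(2) prod.remove[OF I iI, of "\<lambda>i. pois (measure M (g i)) (k i)"]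
      by (simp add: cyl_def C_def pois_def e_def)
    \<comment> \<open>The family is refined at \<open>i0\<close> only: \<open>None\<close> carries
      the part outside \<open>B\<close>, with count 0, and \<open>Some i0\<close> the part inside
      \<open>B\<close>, with count 1. The hit event within the cylinder thus becomes a cylinder
      itself.\<close>
    define g' where "g' = case_option (g i0 - B) (\<lambda>i. if i = i0 then g i0 \<inter> B else g i)"
    define k' where "k' = case_option 0 k"
    let ?I' = "insert None (Some ` I)"
    have gB: "g i0 \<inter> B \<in> finsets" "g i0 - B \<in> finsets"
      by (rule finsets_subset[OF g[OF iI]]; use gM[OF iI] B in auto)+
    have g': "g' j \<in> finsets" if "j \<in> ?I'" for j
      using that g gB by (auto simp: g'_def)
    have disj': "disjoint_family_on g' ?I'"
      using disj iI unfolding disjoint_family_on_def g'_def by (auto split: option.splits)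
    have "hit E B \<inter> cyl I g k = {\<gamma> \<in> space P. \<forall>j\<in>?I'. \<gamma> (g' j) = of_nat (k' j)}"
    proof (intro equalityI subsetI)
      fix \<gamma> assume \<gamma>: "\<gamma> \<in> hit E B \<inter> cyl I g k"
      then have sp: "\<gamma> \<in> space P" and gk: "\<And>i. i \<in> I \<Longrightarrow> \<gamma> (g i) = of_nat (k i)"
        and h1: "\<gamma> (E \<inter> B) = 1" by (auto simp: cyl_def hit_def)
      have EB: "E \<inter> B = (\<Union>i\<in>J. g i \<inter> B)" unfolding E by auto
      have "disjoint_family_on (\<lambda>i. g i \<inter> B) J"
        using disjJ unfolding disjoint_family_on_def by blast
      then have "\<gamma> (E \<inter> B) = (\<Sum>i\<in>J. \<gamma> (g i \<inter> B))"
        unfolding EB using gM B J by (intro count_UN[OF sp fJ]) auto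
      then have "1 = (\<Sum>i\<in>J. \<gamma> (g i \<inter> B))" using h1 by simp
      also have "\<dots> = \<gamma> (g i0 \<inter> B) + (\<Sum>i\<in>J - {i0}. \<gamma> (g i \<inter> B))"
        by (rule sum.remove[OF fJ i0(1)])
      also have "(\<Sum>i\<in>J - {i0}. \<gamma> (g i \<inter> B)) = 0"
      proof (intro sum.neutral ballI)
        fix i assume i: "i \<in> J - {i0}"
        then have "\<gamma> (g i \<inter> B) \<le> \<gamma> (g i)" using J gM B by (intro count_mono[OF sp]) auto
        also have "\<gamma> (g i) = 0" using i i0(3) gk J by auto
        finally show "\<gamma> (g i \<inter> B) = 0" by simp
      qed
      finally have 1: "\<gamma> (g i0 \<inter> B) = 1" by simp
      have "1 = 1 + \<gamma> (g i0 - B)"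
        using count_split[OF sp gM[OF iI] B] gk[OF iI] i0(2) 1 by simp
      then have "\<gamma> (g i0 - B) = 0"
        using ennreal_add_left_cancel[of 1 0 "\<gamma> (g i0 - B)"] by simp
      then show "\<gamma> \<in> {\<gamma> \<in> space P. \<forall>j\<in>?I'. \<gamma> (g' j) = of_nat (k' j)}"
        using sp gk 1 i0(2) by (auto simp: g'_def k'_def)
    next
      fix \<gamma> assume \<gamma>: "\<gamma> \<in> {\<gamma> \<in> space P. \<forall>j\<in>?I'. \<gamma> (g' j) = of_nat (k' j)}"
      then have sp: "\<gamma> \<in> space P" and all: "\<And>j. j \<in> ?I' \<Longrightarrow> \<gamma> (g' j) = of_nat (k' j)" by auto
      have 0: "\<gamma> (g i0 - B) = 0" using all[of None] by (simp add: g'_def k'_def)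
      have 1: "\<gamma> (g i0 \<inter> B) = 1" using all[of "Some i0"] iI i0(2) by (simp add: g'_def k'_def)
      have "\<gamma> (g i) = of_nat (k i)" if "i \<in> I" for i
      proof (cases "i = i0")
        case True
        then show ?thesis using count_split[OF sp gM[OF iI] B] 0 1 i0(2) by simp
      next
        case False
        then show ?thesis using all[of "Some i"] that by (simp add: g'_def k'_def)
      qed
      then have cy: "\<gamma> \<in> cyl I g k" using sp by (simp add: cyl_def)
      have EM: "E \<in> sets M" unfolding E using fJ J gM by (intro sets.finite_UN) auto
      have E1: "\<gamma> E = 1" using cE[OF cy] True by simp
      have "1 \<le> \<gamma> (E \<inter> B)"
        unfolding 1[symmetric] using i0(1) EM B gM[OF iI] by (intro count_mono[OF sp]) (auto simp: E)
      moreover have "\<gamma> (E \<inter> B) \<le> 1"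
        unfolding E1[symmetric] using EM B by (intro count_mono[OF sp]) auto
      ultimately show "\<gamma> \<in> hit E B \<inter> cyl I g k" using cy sp E1 by (auto simp: hit_def)
    qed
    then have "measure P (hit E B \<inter> cyl I g k) = (\<Prod>j\<in>?I'. pois (measure M (g' j)) (k' j))"
      using cylinder[OF _ g' disj', of k'] I by simp
    also have "\<dots> = pois (measure M (g i0 - B)) 0 * (\<Prod>i\<in>I. pois (measure M (g' (Some i))) (k i))"
      using I by (subst prod.insert) (auto simp: prod.reindex g'_def k'_def)
    also have "(\<Prod>i\<in>I. pois (measure M (g' (Some i))) (k i)) = pois (measure M (g i0 \<inter> B)) 1 * C"
      unfolding C_def prod.remove[OF I iI]
      by (intro arg_cong2[where f = "(*)"] prod.cong) (auto simp: g'_def i0(2))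
    \<comment> \<open>The two exponentials multiply to the one of \<open>g i0\<close>. The result
      differs from the one-point probability only by having
      \<open>measure M (g i0 \<inter> B)\<close> in place of
      \<open>measure M (g i0)\<close>.\<close>
    also have "pois (measure M (g i0 - B)) 0 * (pois (measure M (g i0 \<inter> B)) 1 * C)
        = measure M (g i0 \<inter> B) * (e * C)"
    proof -
      have "measure M (g i0) = measure M (g i0 \<inter> B) + measure M (g i0 - B)"
      proof -
        have "g i0 \<in> fmeasurable M" "g i0 \<inter> B \<in> fmeasurable M"
          using g[OF iI] gB(1)
          by (auto simp: finsets_def fmeasurable_def)
        then have "measure M (g i0 \<inter> B \<union> g i0) = measure M (g i0 \<inter> B) + measure M (g i0 - g i0 \<inter> B)"
          by (intro measure_Un2)
        moreover have "g i0 \<inter> B \<union> g i0 = g i0" "g i0 - g i0 \<inter> B = g i0 - B" by auto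
        ultimately show ?thesis by simp
      qed
      then show ?thesis by (simp add: pois_def e_def exp_add[symmetric] algebra_simps)
    qed
    finally have hit: "measure P (hit E B \<inter> cyl I g k) = measure M (g i0 \<inter> B) * (e * C)" .
    have "e * C \<ge> 0" using C0 by (simp add: e_def)
    then show ?thesis
      unfolding hit one_point
      using mult_right_mono[OF a[OF i0(1)]] mult_right_mono[OF b[OF i0(1)]] by (simp add: mult.assoc)
  qed
qed

end

section \<open>Entropy gained from labels\<close>

text \<open>A block of mass \<open>q\<close> is split into masses \<open>p i\<close> and a rest
  \<open>q - u\<close>. By grouping, the entropy terms grow by \<open>u\<close> times the entropy of
  the conditional distribution \<open>p i / u\<close>, plus the nonnegative amount due to splitting
  \<open>q\<close> into \<open>u\<close> and \<open>q - u\<close>. Each \<open>p i / u\<close> is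
  within \<open>\<delta>\<close> of \<open>a i\<close>, which costs at most \<open>e\<close> per
  term.\<close>

lemma neg_xlnx_gain:
  fixes p a :: "'b \<Rightarrow> real"
  assumes fin: "finite I" and p0: "\<And>i. i \<in> I \<Longrightarrow> 0 \<le> p i"
    and u: "u = (\<Sum>i\<in>I. p i)" "u \<le> q"
    and a01: "\<And>i. i \<in> I \<Longrightarrow> a i \<in> {0..1}"
    and a: "\<And>i. i \<in> I \<Longrightarrow> a i * u \<le> p i" and b: "\<And>i. i \<in> I \<Longrightarrow> p i \<le> (a i + \<delta>) * u"
    and mod: "\<And>x y. x \<in> {0..1} \<Longrightarrow> y \<in> {0..1} \<Longrightarrow> \<bar>x - y\<bar> \<le> \<delta> \<Longrightarrow> \<bar>neg_xlnx x - neg_xlnx y\<bar> \<le> e"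
  shows "neg_xlnx q + u * (\<Sum>i\<in>I. neg_xlnx (a i) - e) \<le> neg_xlnx (q - u) + (\<Sum>i\<in>I. neg_xlnx (p i))"
proof (cases "u = 0")
  case True
  then have "p i = 0" if "i \<in> I" for i
    using u(1) p0 that fin sum_nonneg_eq_0_iff[of I p] by auto
  then show ?thesis using True by simp
next
  case False
  have "u \<ge> 0" unfolding u(1) using p0 by (rule sum_nonneg)
  with False have u0: "u > 0" by simp
  have tm: "neg_xlnx (p i) \<ge> u * (neg_xlnx (a i) - e) - p i * ln u" if i: "i \<in> I" for i
  proof -
    define x where "x = p i / u"
    have px: "p i = u * x" using u0 by (simp add: x_def)
    have x0: "0 \<le> x" using p0[OF i] u0 by (simp add: x_def)
    have "p i \<le> u" unfolding u(1) using fin p0 i by (intro member_le_sum) auto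
    then have x1: "x \<le> 1" using u0 by (simp add: x_def)
    have "a i \<le> x" "x \<le> a i + \<delta>"
      using a[OF i] b[OF i] u0 unfolding px by (simp_all add: mult.commute)
    then have "\<bar>neg_xlnx x - neg_xlnx (a i)\<bar> \<le> e" using x0 x1 a01[OF i] by (intro mod) auto
    then have "u * (neg_xlnx (a i) - e) \<le> u * neg_xlnx x" using u0 by (intro mult_left_mono) auto
    moreover have "neg_xlnx (p i) = u * neg_xlnx x - p i * ln u"
      using u0 x0 unfolding px by (cases "x = 0") (auto simp: neg_xlnx_def ln_mult algebra_simps)
    ultimately show ?thesis by simp
  qed
  have "u * (\<Sum>i\<in>I. neg_xlnx (a i) - e) - u * ln u = (\<Sum>i\<in>I. u * (neg_xlnx (a i) - e) - p i * ln u)"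
    by (simp add: sum_subtractf sum_distrib_left[symmetric] sum_distrib_right[symmetric] u(1)[symmetric]
        del: sum_constant)
  also have "\<dots> \<le> (\<Sum>i\<in>I. neg_xlnx (p i))" by (intro sum_mono tm)
  finally have 1: "u * (\<Sum>i\<in>I. neg_xlnx (a i) - e) - u * ln u \<le> (\<Sum>i\<in>I. neg_xlnx (p i))" .
  \<comment> \<open>Monotonicity of the logarithm on both parts gives
    \<open>neg_xlnx q \<le> neg_xlnx (q - u) + neg_xlnx u\<close>.\<close>
  have "u * ln u \<le> u * ln q" using u0 u(2) by (intro mult_left_mono) auto
  moreover have "(q - u) * ln (q - u) \<le> (q - u) * ln q"
    using u0 u(2) by (cases "q = u") (auto intro!: mult_left_mono)
  ultimately have "neg_xlnx q - neg_xlnx (q - u) \<le> - u * ln u" by (simp add: neg_xlnx_def algebra_simps)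
  with 1 show ?thesis by simp
qed

context poisson_process
begin

text \<open>On each cylinder with one point in \<open>E\<close>, that point falls into a single
  cell; this cell is a member of \<open>D\<close> inside \<open>E\<close>, where the share of
  \<open>B\<close> is controlled by hypothesis. Summing over the cylinders on which \<open>Y\<close>
  takes a value in \<open>V\<close> preserves both inequalities.\<close>

lemma hit_sandwich:
  assumes F: "finite F" "F \<subseteq> finsets" and Y: "determined P F Y"
    and E: "E \<in> finsets" "E \<in> sets D" and B: "B \<in> sets M"
    and DF: "\<And>G. G \<in> F \<Longrightarrow> G \<inter> E \<in> sets D"
    and a: "0 \<le> a" "\<And>G. G \<in> sets D \<Longrightarrow> G \<subseteq> E \<Longrightarrow> a * measure M G \<le> measure M (G \<inter> B)"
    and b: "0 \<le> b" "\<And>G. G \<in> sets D \<Longrightarrow> G \<subseteq> E \<Longrightarrow> measure M (G \<inter> B) \<le> b * measure M G"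
  shows "a * measure P (one_point E \<inter> (Y -` V \<inter> space P)) \<le> measure P (hit E B \<inter> (Y -` V \<inter> space P))"
    and "measure P (hit E B \<inter> (Y -` V \<inter> space P)) \<le> b * measure P (one_point E \<inter> (Y -` V \<inter> space P))"
proof -
  \<comment> \<open>\<open>E\<close> is adjoined so that it becomes a union of cells, namely of
    those whose index contains \<open>E\<close>.\<close>
  define F' where "F' = insert E F"
  define I where "I = cells F'"
  define J where "J = {S \<in> I. E \<in> S}"
  have F': "finite F'" "F' \<subseteq> finsets" using F E by (auto simp: F'_def)
  have F'M: "F' \<subseteq> sets M" using F' finsets_sets by auto
  have I: "finite I" unfolding I_def using F'(1) by (rule finite_cells)
  have g: "cell F' S \<in> finsets" if "S \<in> I" for S using cell_finsets[OF F'] that by (simp add: I_def)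
  have disj: "disjoint_family_on (cell F') I" unfolding I_def by (rule disjoint_cells)
  have JI: "J \<subseteq> I" by (auto simp: J_def)
  have EJ: "E = (\<Union>S\<in>J. cell F' S)" using UN_cells[of E F'] by (simp add: J_def I_def F'_def)
  have Y': "determined P (cell F' ` I) Y"
    unfolding I_def using F'(1) F'M
    by (rule determined_cells) (rule determined_mono[OF Y], auto simp: F'_def)
  have cD: "cell F' S \<in> sets D" "cell F' S \<subseteq> E" if "S \<in> J" for S
  proof -
    have S: "S \<subseteq> F'" "E \<in> S" using that by (auto simp: J_def I_def cells_def)
    have D': "A \<inter> E \<in> sets D" if "A \<in> F'" for A using that DF E(2) by (auto simp: F'_def)
    \<comment> \<open>Since \<open>E \<in> S\<close>, all sets may be replaced by their traces on
      \<open>E\<close>, and these are known to lie in \<open>D\<close>.\<close>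
    have "cell F' S = (\<Inter>A\<in>S. A \<inter> E) - (\<Union>A\<in>F' - S. A \<inter> E)"
      using S by (auto simp: cell_def)
    moreover have "(\<Inter>A\<in>S. A \<inter> E) \<in> sets D"
      using S D' finite_subset[OF S(1) F'(1)] by (intro sets.finite_INT) auto
    moreover have "(\<Union>A\<in>F' - S. A \<inter> E) \<in> sets D"
      using D' F'(1) by (intro sets.finite_UN) auto
    ultimately show "cell F' S \<in> sets D" by auto
    show "cell F' S \<subseteq> E" using S by (auto simp: cell_def)
  qed
  let ?R = "Y -` V \<inter> space P"
  have RM: "?R \<in> sets P"
    using F finsets_sets by (intro determined_measurable[OF F(1) _ Y]) auto
  have EM: "E \<in> sets M" using E(1) by (rule finsets_sets)
  have sR: "one_point E \<inter> ?R \<in> sets P" using RM sets_one_point[OF EM] by auto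
  have hR: "hit E B \<inter> ?R \<in> sets P" using RM sets_hit[OF EM B] by auto
  have cyl: "a * measure P (one_point E \<inter> cyl I (cell F') k) \<le> measure P (hit E B \<inter> cyl I (cell F') k) \<and>
    measure P (hit E B \<inter> cyl I (cell F') k) \<le> b * measure P (one_point E \<inter> cyl I (cell F') k)" for k
    by (rule hit_cyl[OF I g disj JI EJ B]) (use cD a(2) b(2) in auto)
  have pw: "ennreal a * emeasure P (one_point E \<inter> ?R \<inter> cyl I (cell F') k) \<le> emeasure P (hit E B \<inter> ?R \<inter> cyl I (cell F') k) \<and>
     emeasure P (hit E B \<inter> ?R \<inter> cyl I (cell F') k) \<le> ennreal b * emeasure P (one_point E \<inter> ?R \<inter> cyl I (cell F') k)" for k
  proof -
    consider "cyl I (cell F') k \<subseteq> ?R" | "?R \<inter> cyl I (cell F') k = {}"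
      using cyl_subset_or_disjoint[OF Y'] by blast
    then show ?thesis
    proof cases
      case 1
      then have "one_point E \<inter> ?R \<inter> cyl I (cell F') k = one_point E \<inter> cyl I (cell F') k"
        "hit E B \<inter> ?R \<inter> cyl I (cell F') k = hit E B \<inter> cyl I (cell F') k" by auto
      then show ?thesis
        using cyl[of k] a(1) b(1) by (simp add: emeasure_eq_measure flip: ennreal_mult)
    next
      case 2
      then have "one_point E \<inter> ?R \<inter> cyl I (cell F') k = {}" "hit E B \<inter> ?R \<inter> cyl I (cell F') k = {}" by auto
      then show ?thesis by simp
    qed
  qed
  let ?C = "count_space (PiE I (\<lambda>_. UNIV :: nat set))"
  note ds = emeasure_decompose[OF I g sR] and dh = emeasure_decompose[OF I g hR]
  have "ennreal a * emeasure P (one_point E \<inter> ?R)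
      = ennreal a * (\<integral>\<^sup>+k. emeasure P (one_point E \<inter> ?R \<inter> cyl I (cell F') k) \<partial>?C)"
    by (rule arg_cong[OF ds])
  also have "\<dots> = (\<integral>\<^sup>+k. ennreal a * emeasure P (one_point E \<inter> ?R \<inter> cyl I (cell F') k) \<partial>?C)"
    by (rule nn_integral_cmult[symmetric]) simp
  also have "\<dots> \<le> (\<integral>\<^sup>+k. emeasure P (hit E B \<inter> ?R \<inter> cyl I (cell F') k) \<partial>?C)"
    using pw by (intro nn_integral_mono) auto
  also have "\<dots> = emeasure P (hit E B \<inter> ?R)" by (rule dh[symmetric])
  finally show "a * measure P (one_point E \<inter> ?R) \<le> measure P (hit E B \<inter> ?R)"
    using a(1) by (simp add: emeasure_eq_measure flip: ennreal_mult)
  have "emeasure P (hit E B \<inter> ?R) = (\<integral>\<^sup>+k. emeasure P (hit E B \<inter> ?R \<inter> cyl I (cell F') k) \<partial>?C)"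
    by (rule dh)
  also have "\<dots> \<le> (\<integral>\<^sup>+k. ennreal b * emeasure P (one_point E \<inter> ?R \<inter> cyl I (cell F') k) \<partial>?C)"
    using pw by (intro nn_integral_mono) auto
  also have "\<dots> = ennreal b * (\<integral>\<^sup>+k. emeasure P (one_point E \<inter> ?R \<inter> cyl I (cell F') k) \<partial>?C)"
    by (rule nn_integral_cmult) simp
  also have "\<dots> = ennreal b * emeasure P (one_point E \<inter> ?R)"
    by (rule arg_cong[OF ds[symmetric]])
  finally show "measure P (hit E B \<inter> ?R) \<le> b * measure P (one_point E \<inter> ?R)"
    using b(1) by (simp add: emeasure_eq_measure flip: ennreal_mult)
qed

text \<open>Collecting all admissible blocks avoids a choice: for a partition \<open>Q\<close> the
  value is a singleton if \<open>E\<close> holds exactly one point and \<open>{}\<close>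
  otherwise.\<close>

definition label :: "'a set set \<Rightarrow> 'a set \<Rightarrow> ('a set \<Rightarrow> ennreal) \<Rightarrow> 'a set set" where
  "label Q E \<gamma> = (if \<gamma> E = 1 then {B \<in> Q. \<gamma> (E \<inter> B) = 1} else {})"

definition label_sets :: "'a set set \<Rightarrow> 'a set \<Rightarrow> 'a set set" where
  "label_sets Q E = insert E ((\<lambda>B. E \<inter> B) ` Q)"

lemma determined_label: "determined P (label_sets Q E) (label Q E)"
  by (auto simp: determined_def label_def label_sets_def)

lemma label_sets_finsets:
  assumes "Q \<subseteq> sets M" "E \<in> finsets"
  shows "label_sets Q E \<subseteq> finsets"
  using assms finsets_subset[OF assms(2)] finsets_sets[OF assms(2)]
  by (auto simp: label_sets_def)

text \<open>If \<open>E\<close> holds one point, the counts of the sets \<open>E \<inter> B\<close>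
  are natural numbers with sum 1, so exactly one of them is 1.\<close>

lemma label_cases:
  assumes Q: "finite Q" "Q \<subseteq> sets M" "disjoint Q" "\<Union>Q = space M" and E: "E \<in> sets M"
    and \<gamma>: "\<gamma> \<in> space P"
  shows "\<gamma> \<in> one_point E \<Longrightarrow> \<exists>B\<in>Q. label Q E \<gamma> = {B}"
    and "B \<in> Q \<Longrightarrow> label Q E \<gamma> = {B} \<longleftrightarrow> \<gamma> \<in> hit E B"
    and "label Q E \<gamma> = {} \<longleftrightarrow> \<gamma> \<notin> one_point E"
proof -
  have one: "\<exists>B\<in>Q. label Q E \<gamma> = {B}" if "\<gamma> \<in> one_point E"
  proof -
    have E1: "\<gamma> E = 1" using that by (simp add: one_point_def)
    have "disjoint_family_on (\<lambda>B. E \<inter> B) Q"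
      using Q(3) unfolding disjoint_family_on_def disjoint_def by blast
    then have "\<gamma> (\<Union>B\<in>Q. E \<inter> B) = (\<Sum>B\<in>Q. \<gamma> (E \<inter> B))"
      using Q E by (intro count_UN[OF \<gamma>]) auto
    moreover have "(\<Union>B\<in>Q. E \<inter> B) = E" using Q(4) sets.sets_into_space[OF E] by auto
    ultimately have sum1: "(\<Sum>B\<in>Q. \<gamma> (E \<inter> B)) = 1" using E1 by simp
    have "\<exists>n. \<gamma> (E \<inter> B) = of_nat n" if "B \<in> Q" for B
    proof -
      have "E \<inter> B \<in> sets M" using that Q E by auto
      moreover have "\<gamma> (E \<inter> B) \<le> 1"
        unfolding E1[symmetric] using that Q E by (intro count_mono[OF \<gamma>]) auto
      ultimately show ?thesis using count_range[OF \<gamma>, of "E \<inter> B"] by (auto simp: top_unique)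
    qed
    then obtain n where n: "\<And>B. B \<in> Q \<Longrightarrow> \<gamma> (E \<inter> B) = of_nat (n B)" by metis
    then have "of_nat (\<Sum>B\<in>Q. n B) = (1 :: ennreal)" using sum1 by simp
    then have "(\<Sum>B\<in>Q. n B) = 1" by (simp only: of_nat_eq_1_iff)
    then obtain B where "B \<in> Q" "n B = 1" "\<And>B'. B' \<in> Q \<Longrightarrow> B \<noteq> B' \<Longrightarrow> n B' = 0"
      using sum_eq_1_iff[OF Q(1), of n] by auto
    then have "label Q E \<gamma> = {B}" using n E1 by (fastforce simp: label_def)
    then show ?thesis using \<open>B \<in> Q\<close> by blast
  qed
  then show "\<gamma> \<in> one_point E \<Longrightarrow> \<exists>B\<in>Q. label Q E \<gamma> = {B}" .
  have out: "label Q E \<gamma> = {}" if "\<gamma> \<notin> one_point E" using that \<gamma> by (simp add: label_def one_point_def)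
  then show "label Q E \<gamma> = {} \<longleftrightarrow> \<gamma> \<notin> one_point E" using one by auto
  show "label Q E \<gamma> = {B} \<longleftrightarrow> \<gamma> \<in> hit E B" if B: "B \<in> Q"
  proof
    assume "label Q E \<gamma> = {B}"
    then show "\<gamma> \<in> hit E B" using \<gamma> by (auto simp: label_def hit_def split: if_splits)
  next
    assume h: "\<gamma> \<in> hit E B"
    then have "B \<in> label Q E \<gamma>" using B by (simp add: label_def hit_def)
    moreover have "\<gamma> \<in> one_point E" using h by (simp add: hit_def one_point_def)
    ultimately show "label Q E \<gamma> = {B}" using one by auto
  qed
qed

text \<open>Each block \<open>Y = y\<close> is split by the label according to
  \<open>neg_xlnx_gain\<close>, with label probabilities supplied by \<open>hit_sandwich\<close>.
  The one-point masses of the blocks add up to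
  \<open>measure M E * exp (- measure M E)\<close>.\<close>

lemma label_gain:
  assumes Q: "finite Q" "Q \<subseteq> sets M" "disjoint Q" "\<Union>Q = space M"
    and F: "finite F" "F \<subseteq> finsets" and Y: "determined P F Y" "finite (Y ` space P)"
    and E: "E \<in> finsets" "E \<in> sets D"
    and DF: "\<And>G. G \<in> F \<Longrightarrow> G \<inter> E \<in> sets D"
    and a01: "\<And>B. B \<in> Q \<Longrightarrow> a B \<in> {0..1}" and \<delta>: "0 \<le> \<delta>"
    and a: "\<And>B G. B \<in> Q \<Longrightarrow> G \<in> sets D \<Longrightarrow> G \<subseteq> E \<Longrightarrow> a B * measure M G \<le> measure M (G \<inter> B)"
    and b: "\<And>B G. B \<in> Q \<Longrightarrow> G \<in> sets D \<Longrightarrow> G \<subseteq> E \<Longrightarrow> measure M (G \<inter> B) \<le> (a B + \<delta>) * measure M G"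
    and mod: "\<And>x y. x \<in> {0..1} \<Longrightarrow> y \<in> {0..1} \<Longrightarrow> \<bar>x - y\<bar> \<le> \<delta> \<Longrightarrow> \<bar>neg_xlnx x - neg_xlnx y\<bar> \<le> e"
  shows "ent P Y + measure M E * exp (- measure M E) * (\<Sum>B\<in>Q. neg_xlnx (a B) - e)
    \<le> ent P (\<lambda>\<gamma>. (label Q E \<gamma>, Y \<gamma>))"
proof -
  let ?V = "Y ` space P" and ?L = "insert {} ((\<lambda>B. {B}) ` Q)"
  let ?Z = "\<lambda>\<gamma>. (label Q E \<gamma>, Y \<gamma>)" and ?c = "\<Sum>B\<in>Q. neg_xlnx (a B) - e"
  have EM: "E \<in> sets M" using E(1) by (rule finsets_sets)
  note lc = label_cases[OF Q EM]
  define f where "f y = Y -` {y} \<inter> space P" for y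
  have fM: "f y \<in> sets P" for y
    unfolding f_def using F finsets_sets by (intro determined_measurable[OF F(1) _ Y(1)]) auto
  have sM: "one_point E \<inter> f y \<in> sets P" for y using fM sets_one_point[OF EM] by auto
  have hM: "hit E B \<inter> f y \<in> sets P" if "B \<in> Q" for y B using fM sets_hit[OF EM, of B] that Q(2) by auto
  have per: "neg_xlnx (measure P (f y)) + measure P (one_point E \<inter> f y) * ?c
      \<le> (\<Sum>l\<in>?L. neg_xlnx (measure P (?Z -` {(l, y)} \<inter> space P)))" for y
  proof -
    let ?u = "measure P (one_point E \<inter> f y)" and ?p = "\<lambda>B. measure P (hit E B \<inter> f y)"
    have un: "one_point E \<inter> f y = (\<Union>B\<in>Q. hit E B \<inter> f y)"
    proof (intro equalityI subsetI)
      fix \<gamma> assume \<gamma>: "\<gamma> \<in> one_point E \<inter> f y"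
      then obtain B where "B \<in> Q" "label Q E \<gamma> = {B}" using lc(1)[of \<gamma>] by (auto simp: f_def)
      then show "\<gamma> \<in> (\<Union>B\<in>Q. hit E B \<inter> f y)" using \<gamma> lc(2)[of \<gamma> B] by (auto simp: f_def)
    qed (auto simp: hit_def one_point_def)
    have "disjoint_family_on (\<lambda>B. hit E B \<inter> f y) Q"
      unfolding disjoint_family_on_def
    proof (intro ballI impI)
      fix B B' assume BB: "B \<in> Q" "B' \<in> Q" "B \<noteq> B'"
      show "(hit E B \<inter> f y) \<inter> (hit E B' \<inter> f y) = {}"
      proof (rule ccontr)
        assume "(hit E B \<inter> f y) \<inter> (hit E B' \<inter> f y) \<noteq> {}"
        then obtain \<gamma> where "\<gamma> \<in> space P" "\<gamma> \<in> hit E B" "\<gamma> \<in> hit E B'" by (auto simp: f_def)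
        then show False using lc(2)[of \<gamma> B] lc(2)[of \<gamma> B'] BB by auto
      qed
    qed
    then have u: "?u = (\<Sum>B\<in>Q. ?p B)"
      unfolding un using hM Q(1) by (intro finite_measure_finite_Union) auto
    have fib: "?Z -` {({B}, y)} \<inter> space P = hit E B \<inter> f y" if "B \<in> Q" for B
      using lc(2) that by (auto simp: f_def hit_def)
    have "?Z -` {({}, y)} \<inter> space P = f y - one_point E \<inter> f y"
      using lc(3) by (auto simp: f_def)
    then have m0: "measure P (?Z -` {({}, y)} \<inter> space P) = measure P (f y) - ?u"
      using finite_measure_Diff[OF fM sM] by auto
    have "neg_xlnx (measure P (f y)) + ?u * ?c \<le> neg_xlnx (measure P (f y) - ?u) + (\<Sum>B\<in>Q. neg_xlnx (?p B))"
    proof (rule neg_xlnx_gain[OF Q(1) _ u _ a01 _ _ mod])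
      show "?u \<le> measure P (f y)" using fM by (intro finite_measure_mono) auto
      fix B assume B: "B \<in> Q"
      have BM: "B \<in> sets M" using B Q(2) by auto
      show "a B * ?u \<le> ?p B" "?p B \<le> (a B + \<delta>) * ?u"
        unfolding f_def using a01[OF B] \<delta> a[OF B] b[OF B]
        by (intro hit_sandwich[OF F Y(1) E BM DF]; auto)+
    qed auto
    also have "\<dots> = (\<Sum>l\<in>?L. neg_xlnx (measure P (?Z -` {(l, y)} \<inter> space P)))"
      using Q(1) fib by (subst sum.insert) (auto simp: m0 sum.reindex intro!: sum.cong)
    finally show ?thesis .
  qed
  have "measure P (one_point E) = (\<Sum>y\<in>?V. measure P (one_point E \<inter> f y))"
  proof -
    have "one_point E = (\<Union>y\<in>?V. one_point E \<inter> f y)" by (auto simp: f_def one_point_def)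
    moreover have "measure P (\<Union>y\<in>?V. one_point E \<inter> f y) = (\<Sum>y\<in>?V. measure P (one_point E \<inter> f y))"
      using sM Y(2) by (intro finite_measure_finite_Union) (auto simp: disjoint_family_on_def f_def)
    ultimately show ?thesis by simp
  qed
  then have "ent P Y + measure M E * exp (- measure M E) * ?c
      = (\<Sum>y\<in>?V. neg_xlnx (measure P (f y)) + measure P (one_point E \<inter> f y) * ?c)"
    using measure_one_point[OF E(1)] by (simp add: ent_def f_def sum.distrib sum_distrib_right)
  also have "\<dots> \<le> (\<Sum>y\<in>?V. \<Sum>l\<in>?L. neg_xlnx (measure P (?Z -` {(l, y)} \<inter> space P)))"
    by (intro sum_mono per)
  also have "\<dots> = (\<Sum>l\<in>?L. \<Sum>y\<in>?V. neg_xlnx (measure P (?Z -` {(l, y)} \<inter> space P)))"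
    by (rule sum.swap)
  also have "\<dots> = (\<Sum>v\<in>?L \<times> ?V. neg_xlnx (measure P (?Z -` {v} \<inter> space P)))"
    by (simp add: sum.cartesian_product split_def)
  also have "\<dots> = ent P ?Z"
  proof (rule ent_superset[symmetric])
    show "?Z ` space P \<subseteq> ?L \<times> ?V"
    proof
      fix z assume "z \<in> ?Z ` space P"
      then obtain \<gamma> where \<gamma>: "\<gamma> \<in> space P" "z = ?Z \<gamma>" by auto
      then show "z \<in> ?L \<times> ?V" using lc(1)[OF \<gamma>(1)] lc(3)[OF \<gamma>(1)] by auto
    qed
  qed (use Q Y in auto)
  finally show ?thesis .
qed

text \<open>Induction over the pieces, where the labels already read are adjoined to
  \<open>Y\<close> and thereby become part of what is conditioned on.\<close>

lemma labels_gain: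
  assumes Q: "finite Q" "Q \<subseteq> sets M" "disjoint Q" "\<Union>Q = space M"
    and F: "finite F" "F \<subseteq> finsets" and Y: "determined P F Y" "finite (Y ` space P)"
    and J: "finite J" and E: "\<And>j. j \<in> J \<Longrightarrow> E j \<in> finsets \<and> E j \<in> sets D"
    and disj: "disjoint_family_on E J"
    and DF: "\<And>G j. j \<in> J \<Longrightarrow> G \<in> F \<Longrightarrow> G \<inter> E j \<in> sets D"
    and a01: "\<And>j B. j \<in> J \<Longrightarrow> B \<in> Q \<Longrightarrow> a j B \<in> {0..1}" and \<delta>: "0 \<le> \<delta>"
    and a: "\<And>j B G. j \<in> J \<Longrightarrow> B \<in> Q \<Longrightarrow> G \<in> sets D \<Longrightarrow> G \<subseteq> E j \<Longrightarrow> a j B * measure M G \<le> measure M (G \<inter> B)"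
    and b: "\<And>j B G. j \<in> J \<Longrightarrow> B \<in> Q \<Longrightarrow> G \<in> sets D \<Longrightarrow> G \<subseteq> E j \<Longrightarrow> measure M (G \<inter> B) \<le> (a j B + \<delta>) * measure M G"
    and mod: "\<And>x y. x \<in> {0..1} \<Longrightarrow> y \<in> {0..1} \<Longrightarrow> \<bar>x - y\<bar> \<le> \<delta> \<Longrightarrow> \<bar>neg_xlnx x - neg_xlnx y\<bar> \<le> e"
  shows "ent P Y + (\<Sum>j\<in>J. measure M (E j) * exp (- measure M (E j)) * (\<Sum>B\<in>Q. neg_xlnx (a j B) - e))
    \<le> ent P (\<lambda>\<gamma>. (\<lambda>j\<in>J. label Q (E j) \<gamma>, Y \<gamma>))"
proof -
  define W where "W K \<gamma> = (\<lambda>j\<in>K. label Q (E j) \<gamma>, Y \<gamma>)" for K \<gamma>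
  define FK where "FK K = F \<union> (\<Union>l\<in>K. label_sets Q (E l))" for K
  have FK: "finite (FK K)" "FK K \<subseteq> finsets" if "K \<subseteq> J" for K
  proof -
    show "finite (FK K)"
      using F(1) Q(1) finite_subset[OF that J] by (auto simp: FK_def label_sets_def)
    have "label_sets Q (E l) \<subseteq> finsets" if "l \<in> K" for l
      using that \<open>K \<subseteq> J\<close> E by (intro label_sets_finsets[OF Q(2)]) auto
    then show "FK K \<subseteq> finsets" using F(2) by (auto simp: FK_def)
  qed
  have WK: "determined P (FK K) (W K)" "finite (W K ` space P)" if "K \<subseteq> J" for K
  proof -
    have "label Q (E l) \<gamma> = label Q (E l) \<gamma>'"
      if "l \<in> K" "\<gamma> \<in> space P" "\<gamma>' \<in> space P" "\<forall>B\<in>FK K. \<gamma> B = \<gamma>' B" for l \<gamma> \<gamma>'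
      using that by (intro determinedD[OF determined_label]) (auto simp: FK_def)
    note lab = this
    have yy: "Y \<gamma> = Y \<gamma>'"
      if "\<gamma> \<in> space P" "\<gamma>' \<in> space P" "\<forall>B\<in>FK K. \<gamma> B = \<gamma>' B" for \<gamma> \<gamma>'
      using that by (intro determinedD[OF Y(1)]) (auto simp: FK_def)
    show "determined P (FK K) (W K)"
      unfolding determined_def
    proof (intro ballI impI)
      fix \<gamma> \<gamma>' assume \<gamma>: "\<gamma> \<in> space P" "\<gamma>' \<in> space P" "\<forall>B\<in>FK K. \<gamma> B = \<gamma>' B"
      show "W K \<gamma> = W K \<gamma>'"
        unfolding W_def by (rule arg_cong2[where f = Pair, OF restrict_ext]; rule lab[OF _ \<gamma>] yy[OF \<gamma>])
    qed
    have "W K ` space P \<subseteq> PiE K (\<lambda>_. Pow Q) \<times> Y ` space P"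
      by (auto simp: W_def label_def split: if_splits)
    moreover have "finite (PiE K (\<lambda>_. Pow Q))"
      using finite_subset[OF that J] Q(1) by (intro finite_PiE) auto
    ultimately show "finite (W K ` space P)" using Y(2) finite_subset by blast
  qed
  have sf: "simple_function P (W K)" if "K \<subseteq> J" for K
    using FK[OF that] WK[OF that] finsets_sets by (intro determined_simple_function[of "FK K"]) auto
  have "ent P Y + (\<Sum>j\<in>J. measure M (E j) * exp (- measure M (E j)) * (\<Sum>B\<in>Q. neg_xlnx (a j B) - e))
    \<le> ent P (W J)"
    using J subset_refl[of J]
  proof (induction rule: finite_subset_induct')
    case empty
    have "ent P Y \<le> ent P (W {})"
      by (rule ent_compose_le[OF sf, where f = snd]) (auto simp: W_def)
    then show ?case by (simp only: sum.empty add_0_right)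
  next
    case (insert j K)
    have "ent P (W K) + measure M (E j) * exp (- measure M (E j)) * (\<Sum>B\<in>Q. neg_xlnx (a j B) - e)
        \<le> ent P (\<lambda>\<gamma>. (label Q (E j) \<gamma>, W K \<gamma>))"
    proof (rule label_gain[OF Q FK[OF insert(3)] WK[OF insert(3)] _ _ _ a01[OF insert(2)] \<delta> a[OF insert(2)] b[OF insert(2)] mod])
      show "E j \<in> finsets" "E j \<in> sets D" using E insert by auto
      fix G assume G: "G \<in> FK K"
      show "G \<inter> E j \<in> sets D"
      proof (cases "G \<in> F")
        case True
        then show ?thesis using DF insert by auto
      next
        case False
        \<comment> \<open>A set used by an earlier label lies in another piece \<open>E l\<close>,
          so its trace on \<open>E j\<close> is empty and hence in \<open>D\<close>.\<close>
        then obtain l where l: "l \<in> K" "G \<subseteq> E l" using G by (auto simp: FK_def label_sets_def)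
        have "l \<noteq> j" "l \<in> J" using l(1) insert(3,4) by auto
        then have "E l \<inter> E j = {}" using disj insert(2) unfolding disjoint_family_on_def by blast
        then have "G \<inter> E j = {}" using l by auto
        then show ?thesis by simp
      qed
    qed
    also have "\<dots> \<le> ent P (W (insert j K))"
      by (rule ent_compose_le[OF sf, where f = "\<lambda>(h, y). (h j, restrict h K, y)"])
        (use insert in \<open>auto simp: W_def\<close>)
    finally show ?case using insert by simp
  qed
  then show ?thesis by (simp only: W_def[abs_def])
qed

end

section \<open>A lower bound for the Poisson entropy\<close>

context poisson_process
begin

text \<open>The class of observations on which invariance of the Poisson law is available. The
  parameter \<C> records which sets are looked at, so that one push-forward can be seen to lead from
  \<open>sets C\<close> into \<open>sets D\<close>.\<close>

definition observable :: "'a set set \<Rightarrow> (('a set \<Rightarrow> ennreal) \<Rightarrow> 'c) \<Rightarrow> bool" where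
  "observable \<C> Z \<longleftrightarrow> (\<exists>F. finite F \<and> F \<subseteq> finsets \<inter> \<C> \<and> determined P F Z) \<and> finite (Z ` space P)"

lemma observable_simple_function:
  assumes "observable \<C> Z"
  shows "simple_function P Z"
proof -
  obtain F where "finite F" "F \<subseteq> finsets" "determined P F Z" "finite (Z ` space P)"
    using assms by (auto simp: observable_def)
  then show ?thesis using finsets_sets by (intro determined_simple_function[of F]) auto
qed

lemma observable_compose:
  assumes "observable \<C> Z"
  shows "observable \<C> (\<lambda>\<gamma>. f (Z \<gamma>))"
proof -
  obtain F where F: "finite F" "F \<subseteq> finsets \<inter> \<C>" "determined P F Z" and fin: "finite (Z ` space P)"
    using assms unfolding observable_def by blast
  have "determined P F (\<lambda>\<gamma>. f (Z \<gamma>))"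
    unfolding determined_def by (intro ballI impI arg_cong[of _ _ f] determinedD[OF F(3)]) auto
  moreover have "finite ((\<lambda>\<gamma>. f (Z \<gamma>)) ` space P)"
    using finite_imageI[OF fin, of f] by (simp add: image_image)
  ultimately show ?thesis using F(1,2) unfolding observable_def by blast
qed

lemma observable_Pair:
  assumes "observable \<C> Y" "observable \<C> Z"
  shows "observable \<C> (\<lambda>\<gamma>. (Y \<gamma>, Z \<gamma>))"
proof -
  obtain F G where "finite F" "F \<subseteq> finsets \<inter> \<C>" "determined P F Y"
    "finite G" "G \<subseteq> finsets \<inter> \<C>" "determined P G Z"
    using assms by (auto simp: observable_def)
  then have "\<exists>H. finite H \<and> H \<subseteq> finsets \<inter> \<C> \<and> determined P H (\<lambda>\<gamma>. (Y \<gamma>, Z \<gamma>))"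
    by (intro exI[of _ "F \<union> G"]) (simp add: determined_Pair)
  moreover have "(\<lambda>\<gamma>. (Y \<gamma>, Z \<gamma>)) ` space P \<subseteq> Y ` space P \<times> Z ` space P" by auto
  then have "finite ((\<lambda>\<gamma>. (Y \<gamma>, Z \<gamma>)) ` space P)"
    by (rule finite_subset) (use assms in \<open>auto simp: observable_def\<close>)
  ultimately show ?thesis by (simp add: observable_def)
qed

lemma observable_push:
  assumes T: "measure_preserving M T" and Z: "observable \<C> Z"
    and CD: "\<And>B. B \<in> \<C> \<Longrightarrow> T -` B \<inter> space M \<in> \<D>"
  shows "observable \<D> (\<lambda>\<gamma>. Z (push_counting M T \<gamma>))"
proof -
  have TM: "T \<in> M \<rightarrow>\<^sub>M M" using T by (simp add: measure_preserving_def)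
  obtain F where F: "finite F" "F \<subseteq> finsets \<inter> \<C>" "determined P F Z"
    using Z by (auto simp: observable_def)
  have "(\<lambda>B. T -` B \<inter> space M) ` F \<subseteq> finsets \<inter> \<D>"
    using F(2) CD measure_preserving_emeasure[OF T] by (auto simp: finsets_def)
  moreover have "determined P ((\<lambda>B. T -` B \<inter> space M) ` F) (\<lambda>\<gamma>. Z (push_counting M T \<gamma>))"
    using F finsets_sets by (intro determined_push[OF TM]) auto
  moreover have "(\<lambda>\<gamma>. Z (push_counting M T \<gamma>)) ` space P \<subseteq> Z ` space P"
    using push_counting_space[OF TM] by auto
  then have "finite ((\<lambda>\<gamma>. Z (push_counting M T \<gamma>)) ` space P)"
    by (rule finite_subset) (use Z in \<open>auto simp: observable_def\<close>)
  ultimately show ?thesis using F(1) unfolding observable_def by blast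
qed

text \<open>Summing over the finite range of \<open>Z\<close>, which contains that of the pushed
  observation, allows \<open>stationary\<close> to be applied value by value.\<close>

lemma ent_push:
  assumes T: "measure_preserving M T" and Z: "observable \<C> Z"
  shows "ent P (\<lambda>\<gamma>. Z (push_counting M T \<gamma>)) = ent P Z"
proof -
  have TM: "T \<in> M \<rightarrow>\<^sub>M M" using T by (simp add: measure_preserving_def)
  obtain F where F: "finite F" "F \<subseteq> finsets" "determined P F Z"
    using Z by (auto simp: observable_def)
  have "ent P (\<lambda>\<gamma>. Z (push_counting M T \<gamma>))
      = (\<Sum>v\<in>Z ` space P. neg_xlnx (measure P ((\<lambda>\<gamma>. Z (push_counting M T \<gamma>)) -` {v} \<inter> space P)))"
    using Z push_counting_space[OF TM] by (intro ent_superset) (auto simp: observable_def)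
  then show ?thesis unfolding stationary[OF T F] ent_def .
qed

text \<open>The vector of labels looks at sets of \<open>C\<close>, and the push-forward turns these
  into members of \<open>D\<close>. The future itinerary of any length is therefore observed through
  \<open>D\<close> alone, which provides the traces required by \<open>labels_gain\<close>.\<close>

lemma ks_entropy_ge_labels:
  assumes T: "measure_preserving M T"
    and C: "sets C \<subseteq> sets M"
    and TC: "\<And>B. B \<in> sets C \<Longrightarrow> T -` B \<inter> space M \<in> sets D"
    and DC: "sets D \<subseteq> sets C"
    and Q: "finite Q" "Q \<subseteq> sets C" "disjoint Q" "\<Union>Q = space M"
    and J: "finite J" and E: "\<And>j. j \<in> J \<Longrightarrow> E j \<in> finsets \<and> E j \<in> sets D"
    and disj: "disjoint_family_on E J"
    and a01: "\<And>j B. j \<in> J \<Longrightarrow> B \<in> Q \<Longrightarrow> a j B \<in> {0..1}" and \<delta>: "0 \<le> \<delta>"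
    and a: "\<And>j B G. j \<in> J \<Longrightarrow> B \<in> Q \<Longrightarrow> G \<in> sets D \<Longrightarrow> G \<subseteq> E j \<Longrightarrow> a j B * measure M G \<le> measure M (G \<inter> B)"
    and b: "\<And>j B G. j \<in> J \<Longrightarrow> B \<in> Q \<Longrightarrow> G \<in> sets D \<Longrightarrow> G \<subseteq> E j \<Longrightarrow> measure M (G \<inter> B) \<le> (a j B + \<delta>) * measure M G"
    and mod: "\<And>x y. x \<in> {0..1} \<Longrightarrow> y \<in> {0..1} \<Longrightarrow> \<bar>x - y\<bar> \<le> \<delta> \<Longrightarrow> \<bar>neg_xlnx x - neg_xlnx y\<bar> \<le> e"
  shows "ennreal (\<Sum>j\<in>J. measure M (E j) * exp (- measure M (E j)) * (\<Sum>B\<in>Q. neg_xlnx (a j B) - e))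
    \<le> ks_entropy P (push_counting M T)"
proof -
  let ?S = "push_counting M T"
  define X where "X \<gamma> = (\<lambda>j\<in>J. label Q (E j) \<gamma>)" for \<gamma>
  have TM: "T \<in> M \<rightarrow>\<^sub>M M" using T by (simp add: measure_preserving_def)
  have S: "?S \<in> space P \<rightarrow> space P" using push_counting_space[OF TM] by auto
  have TCC: "T -` B \<inter> space M \<in> sets C" if "B \<in> sets C" for B using TC[OF that] DC by auto
  have QM: "Q \<subseteq> sets M" using Q C by auto
  have obs_X: "observable (sets C) X"
  proof -
    let ?F = "\<Union>l\<in>J. label_sets Q (E l)"
    have "label_sets Q (E l) \<subseteq> finsets \<inter> sets C" if "l \<in> J" for l
    proof -
      have "label_sets Q (E l) \<subseteq> finsets" using E[OF that] by (intro label_sets_finsets[OF QM]) auto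
      moreover have "E l \<in> sets C" using E[OF that] DC by auto
      then have "label_sets Q (E l) \<subseteq> sets C" using Q(2) by (auto simp: label_sets_def)
      ultimately show ?thesis by auto
    qed
    then have "?F \<subseteq> finsets \<inter> sets C" by auto
    moreover have "finite ?F" using Q(1) J by (auto simp: label_sets_def)
    moreover have "determined P ?F X"
      unfolding determined_def
    proof (intro ballI impI)
      fix \<gamma> \<gamma>' assume \<gamma>: "\<gamma> \<in> space P" "\<gamma>' \<in> space P" "\<forall>B\<in>?F. \<gamma> B = \<gamma>' B"
      show "X \<gamma> = X \<gamma>'" unfolding X_def
      proof (rule restrict_ext)
        fix l assume "l \<in> J"
        then show "label Q (E l) \<gamma> = label Q (E l) \<gamma>'"
          using \<gamma>(3) by (intro determinedD[OF determined_label \<gamma>(1,2)]) blast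
      qed
    qed
    moreover have "X ` space P \<subseteq> PiE J (\<lambda>_. Pow Q)" by (auto simp: X_def label_def split: if_splits)
    then have "finite (X ` space P)"
      by (rule finite_subset) (use J Q(1) in \<open>auto intro!: finite_PiE\<close>)
    ultimately show ?thesis unfolding observable_def by blast
  qed
  have obs_S: "observable (sets C) (\<lambda>\<gamma>. Z ((?S ^^ m) \<gamma>))" if "observable (sets C) Z" for m and Z :: "('a set \<Rightarrow> ennreal) \<Rightarrow> 'c"
  proof (induction m)
    case (Suc m)
    show ?case using observable_push[OF T Suc TCC] by (simp add: funpow_swap1)
  qed (use that in simp)
  have ent_S: "ent P (\<lambda>\<gamma>. Z ((?S ^^ m) \<gamma>)) = ent P Z" if "observable (sets C) Z" for m and Z :: "('a set \<Rightarrow> ennreal) \<Rightarrow> 'c"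
  proof (induction m)
    case (Suc m)
    then show ?case using ent_push[OF T obs_S[OF that, of m]] by (simp add: funpow_swap1)
  qed simp
  have obs_it: "observable (sets C) (itinerary ?S X n)" for n
  proof (induction n)
    case 0
    have "observable (sets C) (\<lambda>\<gamma>. (\<lambda>_. []) (X \<gamma>))" using obs_X by (rule observable_compose)
    then show ?case by (simp add: itinerary_def)
  next
    case (Suc n)
    have "observable (sets C) (\<lambda>\<gamma>. (X \<gamma>, itinerary ?S X n (?S \<gamma>)))"
      using obs_X observable_push[OF T Suc TCC] by (rule observable_Pair)
    then have "observable (sets C) (\<lambda>\<gamma>. (\<lambda>(x, xs). x # xs) (X \<gamma>, itinerary ?S X n (?S \<gamma>)))"
      by (rule observable_compose)
    moreover have "itinerary ?S X (Suc n) = (\<lambda>\<gamma>. X \<gamma> # itinerary ?S X n (?S \<gamma>))"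
      by (rule ext) (rule itinerary_Suc)
    ultimately show ?case by simp
  qed
  show ?thesis
  proof (rule ks_entropy_ge[OF prob_space_axioms S])
    show "simple_function P (\<lambda>\<gamma>. X ((?S ^^ i) \<gamma>))" for i
      using obs_S[OF obs_X] by (rule observable_simple_function)
    show "ent P (\<lambda>\<gamma>. itinerary ?S X n ((?S ^^ m) \<gamma>)) = ent P (itinerary ?S X n)" for n m
      using obs_it by (rule ent_S)
    fix n
    have "observable (sets D) (\<lambda>\<gamma>. itinerary ?S X n (?S \<gamma>))"
      using T obs_it TC by (rule observable_push)
    then obtain F where F: "finite F" "F \<subseteq> finsets \<inter> sets D"
      "determined P F (\<lambda>\<gamma>. itinerary ?S X n (?S \<gamma>))" "finite ((\<lambda>\<gamma>. itinerary ?S X n (?S \<gamma>)) ` space P)"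
      unfolding observable_def by blast
    show "ent P (\<lambda>\<gamma>. itinerary ?S X n (?S \<gamma>))
        + (\<Sum>j\<in>J. measure M (E j) * exp (- measure M (E j)) * (\<Sum>B\<in>Q. neg_xlnx (a j B) - e))
      \<le> ent P (\<lambda>\<gamma>. (X \<gamma>, itinerary ?S X n (?S \<gamma>)))"
      unfolding X_def
      by (rule labels_gain[OF Q(1) QM Q(3,4) F(1) _ F(3,4)[unfolded X_def] J E disj _ a01 \<delta> a b mod])
        (use F(2) E in auto)
  qed
qed

end

section \<open>Absence of atoms\<close>

text \<open>Exhaustion: finite unions of small sets approach their supremal mass, and what they miss
  is null, since otherwise one more small set could be added. As \<open>E\<close> has finite
  measure, the remainder after finitely many steps has mass below \<open>\<epsilon>\<close> and is
  the last member of the cover.\<close>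

lemma finite_small_cover:
  fixes M :: "'a measure"
  assumes D: "subalgebra M D" and E: "E \<in> sets D" "emeasure M E < \<infinity>" and \<epsilon>: "(\<epsilon> :: real) > 0"
    and small: "\<And>B. B \<in> sets D \<Longrightarrow> B \<subseteq> E \<Longrightarrow> 0 < emeasure M B \<Longrightarrow>
      \<exists>B'\<in>sets D. B' \<subseteq> B \<and> 0 < emeasure M B' \<and> emeasure M B' \<le> ennreal \<epsilon>"
  shows "\<exists>W. finite W \<and> W \<subseteq> sets D \<and> \<Union>W = E \<and> (\<forall>B\<in>W. emeasure M B \<le> ennreal \<epsilon>)"
proof -
  have DM: "B \<in> sets M" if "B \<in> sets D" for B using D that by (auto simp: subalgebra_def)
  define U where "U = {\<Union>W |W. finite W \<and> W \<subseteq> sets D \<and> \<Union>W \<subseteq> E \<and> (\<forall>B\<in>W. emeasure M B \<le> ennreal \<epsilon>)}"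
  have U_empty: "{} \<in> U" unfolding U_def by (intro CollectI exI[of _ "{}"]) auto
  have U_sets: "B \<in> sets D" "B \<subseteq> E" if "B \<in> U" for B
    using that by (auto simp: U_def intro: sets.finite_Union)
  have U_Un: "A \<union> B \<in> U" if "A \<in> U" "B \<in> U" for A B
  proof -
    obtain W W' where "A = \<Union>W" "B = \<Union>W'" "finite W" "finite W'" "W \<subseteq> sets D" "W' \<subseteq> sets D"
      "\<Union>W \<subseteq> E" "\<Union>W' \<subseteq> E" "\<forall>B\<in>W. emeasure M B \<le> ennreal \<epsilon>" "\<forall>B\<in>W'. emeasure M B \<le> ennreal \<epsilon>"
      using \<open>A \<in> U\<close> \<open>B \<in> U\<close> unfolding U_def by auto
    then show ?thesis unfolding U_def by (intro CollectI exI[of _ "W \<union> W'"]) auto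
  qed
  define s where "s = (SUP B\<in>U. emeasure M B)"
  obtain f :: "nat \<Rightarrow> 'a set" where f: "\<And>n. f n \<in> U" "s = (SUP n. emeasure M (f n))"
  proof -
    have "U \<noteq> {}" using U_empty by auto
    from ennreal_SUP_countable_SUP[OF this, of "emeasure M"] obtain g :: "nat \<Rightarrow> ennreal"
      where g: "range g \<subseteq> emeasure M ` U" "s = (SUP n. g n)"
      unfolding s_def by blast
    then have "\<exists>B\<in>U. g n = emeasure M B" for n by (auto simp: image_subset_iff image_iff)
    then obtain f where "\<And>n. f n \<in> U" "\<And>n. g n = emeasure M (f n)" by metis
    then have "s = (SUP n. emeasure M (f n))" using g(2) by simp
    with \<open>\<And>n. f n \<in> U\<close> show thesis by (rule that)
  qed
  have fD: "f n \<in> sets D" "f n \<subseteq> E" for n using U_sets[OF f(1)] by auto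
  define A where "A n = (\<Union>i\<le>n. f i)" for n
  have A_U: "A n \<in> U" for n
  proof (induction n)
    case 0 then show ?case using f(1) by (simp add: A_def)
  next
    case (Suc n)
    have "A (Suc n) = A n \<union> f (Suc n)" by (auto simp: A_def atMost_Suc)
    then show ?case using Suc f(1) U_Un by simp
  qed
  have AM: "A n \<in> sets M" for n using U_sets(1)[OF A_U] DM by auto
  have incA: "incseq A" unfolding A_def incseq_def by force
  define R where "R = E - (\<Union>n. A n)"
  have RD: "R \<in> sets D" unfolding R_def using E(1) U_sets(1)[OF A_U] by auto
  have "emeasure M R = 0"
  proof (rule ccontr)
    assume "emeasure M R \<noteq> 0"
    then have "0 < emeasure M R" by (simp add: zero_less_iff_neq_zero)
    then obtain B where B: "B \<in> sets D" "B \<subseteq> R" "0 < emeasure M B" "emeasure M B \<le> ennreal \<epsilon>"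
      using small[OF RD] by (auto simp: R_def)
    have "B \<in> U" unfolding U_def using B by (intro CollectI exI[of _ "{B}"]) (auto simp: R_def)
    \<comment> \<open>Each \<open>f n \<union> B\<close> is again a finite union of small sets; in
      the limit the mass of \<open>B\<close> would be gained on top of the finite supremum
      \<open>s\<close>.\<close>
    have le: "emeasure M (f n) + emeasure M B \<le> s" for n
    proof -
      have "f n \<inter> B = {}" using B(2) by (auto simp: R_def A_def)
      then have "emeasure M (f n) + emeasure M B = emeasure M (f n \<union> B)"
        using fD B(1) DM by (intro plus_emeasure) auto
      also have "\<dots> \<le> s" unfolding s_def using U_Un[OF f(1) \<open>B \<in> U\<close>] by (rule SUP_upper)
      finally show ?thesis .
    qed
    have "s + emeasure M B = (SUP n. emeasure M (f n) + emeasure M B)"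
      unfolding f(2) by (rule ennreal_SUP_add_left[symmetric]) auto
    also have "\<dots> \<le> s" using le by (intro SUP_least)
    finally have "s + emeasure M B \<le> s + 0" by simp
    moreover have "s \<le> emeasure M E"
      unfolding s_def using U_sets E DM by (intro SUP_least emeasure_mono) auto
    then have "s < top" using E(2) by auto
    ultimately show False using B(3) by (auto simp: ennreal_add_left_cancel_le)
  qed
  have "(\<lambda>n. emeasure M (E - A n)) \<longlonglongrightarrow> emeasure M (\<Inter>n. E - A n)"
  proof (rule Lim_emeasure_decseq)
    show "range (\<lambda>n. E - A n) \<subseteq> sets M" using AM E(1) DM by auto
    show "decseq (\<lambda>n. E - A n)" using incA by (auto simp: decseq_def incseq_def)
    show "emeasure M (E - A n) \<noteq> \<infinity>" for n
      using emeasure_mono[of "E - A n" E M] E DM by auto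
  qed
  moreover have "(\<Inter>n. E - A n) = R" by (auto simp: R_def)
  ultimately have "(\<lambda>n. emeasure M (E - A n)) \<longlonglongrightarrow> 0" using \<open>emeasure M R = 0\<close> by simp
  then have "\<forall>\<^sub>F n in sequentially. emeasure M (E - A n) < ennreal \<epsilon>"
    by (rule order_tendstoD) (use \<epsilon> in simp)
  then obtain n where n: "emeasure M (E - A n) < ennreal \<epsilon>" using eventually_sequentially by auto
  obtain W where W: "A n = \<Union>W" "finite W" "W \<subseteq> sets D" "\<Union>W \<subseteq> E" "\<forall>B\<in>W. emeasure M B \<le> ennreal \<epsilon>"
    using A_U[of n] by (auto simp: U_def)
  have "E - A n \<in> sets D" using E(1) U_sets(1)[OF A_U] by auto
  then show ?thesis
    using W n U_sets(2)[OF A_U, of n] by (intro exI[of _ "insert (E - A n) W"]) auto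
qed

text \<open>Repeated halving: every set of positive finite measure splits, and one of the halves carries
  at most half of the mass.\<close>

lemma small_subset:
  fixes M :: "'a measure"
  assumes D: "subalgebra M D"
    and split: "\<And>B. B \<in> sets D \<Longrightarrow> 0 < emeasure M B \<Longrightarrow> emeasure M B < \<infinity> \<Longrightarrow>
      \<exists>B'\<in>sets D. B' \<subseteq> B \<and> 0 < emeasure M B' \<and> emeasure M B' < emeasure M B"
    and B: "B \<in> sets D" "0 < emeasure M B" "emeasure M B < \<infinity>" and \<epsilon>: "(\<epsilon> :: real) > 0"
  shows "\<exists>B'\<in>sets D. B' \<subseteq> B \<and> 0 < emeasure M B' \<and> emeasure M B' \<le> ennreal \<epsilon>"
proof -
  have DM: "B \<in> sets M" if "B \<in> sets D" for B using D that by (auto simp: subalgebra_def)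
  have halves: "\<exists>B'\<in>sets D. B' \<subseteq> B \<and> 0 < emeasure M B' \<and> 2 ^ n * emeasure M B' \<le> emeasure M B" for n
  proof (induction n)
    case (Suc n)
    then obtain A where A: "A \<in> sets D" "A \<subseteq> B" "0 < emeasure M A" "2 ^ n * emeasure M A \<le> emeasure M B"
      by auto
    have "emeasure M A < \<infinity>" using A B DM emeasure_mono[of A B M] by auto
    then obtain A' where A': "A' \<in> sets D" "A' \<subseteq> A" "0 < emeasure M A'" "emeasure M A' < emeasure M A"
      using split A by blast
    have fin: "emeasure M A' \<noteq> \<infinity>" using A'(4) by auto
    have sum: "emeasure M A = emeasure M A' + emeasure M (A - A')"
      using A A' DM plus_emeasure[of A' M "A - A'"] by (simp add: Un_absorb1)
    have pos: "0 < emeasure M (A - A')"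
      using A'(4) sum by (auto simp: zero_less_iff_neq_zero)
    obtain A'' where A'': "A'' \<in> sets D" "A'' \<subseteq> A" "0 < emeasure M A''" "2 * emeasure M A'' \<le> emeasure M A"
    proof (cases "emeasure M A' \<le> emeasure M (A - A')")
      case True
      then have "2 * emeasure M A' \<le> emeasure M A" unfolding sum by (simp add: mult_2 add_left_mono)
      then show thesis using that A' by blast
    next
      case False
      then have "2 * emeasure M (A - A') \<le> emeasure M A" unfolding sum by (simp add: mult_2 add_right_mono)
      moreover have "A - A' \<in> sets D" using A A' by auto
      ultimately show thesis using that pos by blast
    qed
    have "2 ^ Suc n * emeasure M A'' = 2 ^ n * (2 * emeasure M A'')" by (simp add: mult_ac)
    also have "\<dots> \<le> 2 ^ n * emeasure M A" using A''(4) by (intro mult_left_mono) auto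
    also have "\<dots> \<le> emeasure M B" by fact
    finally show ?case using A'' A(2) by blast
  qed (use B in auto)
  obtain n :: nat where n: "measure M B / \<epsilon> < 2 ^ n" using real_arch_pow[of 2 "measure M B / \<epsilon>"] by auto
  obtain B' where B': "B' \<in> sets D" "B' \<subseteq> B" "0 < emeasure M B'" "2 ^ n * emeasure M B' \<le> emeasure M B"
    using halves[of n] by auto
  have eB: "emeasure M B = ennreal (measure M B)" using B(3) by (simp add: emeasure_eq_ennreal_measure)
  have "emeasure M B' \<le> emeasure M B" using B' B DM by (intro emeasure_mono) auto
  then have eB': "emeasure M B' = ennreal (measure M B')"
    using B(3) by (intro emeasure_eq_ennreal_measure) auto
  have "ennreal (2 ^ n * measure M B') \<le> ennreal (measure M B)"
    using B'(4) unfolding eB eB' by (simp add: ennreal_mult flip: ennreal_power)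
  then have "2 ^ n * measure M B' \<le> measure M B" by (simp add: ennreal_le_iff)
  also have "\<dots> < 2 ^ n * \<epsilon>" using n \<epsilon> by (simp add: field_simps)
  finally have "measure M B' \<le> \<epsilon>" by simp
  then have "emeasure M B' \<le> ennreal \<epsilon>" unfolding eB' by (rule ennreal_leI)
  then show ?thesis using B' by blast
qed

text \<open>An atom \<open>A\<close> recurs by conservativity, hence coincides with some \<open>(T ^^ n) -` A\<close> up to a null
  set; then \<open>limsup (T ^^ m) -` A\<close> is strictly invariant of positive finite measure.\<close>

lemma type_II_infty_no_atom:
  assumes II: "type_II_infty M T" and C: "subalgebra M C"
    and TC: "\<And>B. B \<in> sets C \<Longrightarrow> T -` B \<inter> space M \<in> sets C"
    and A: "A \<in> sets C" "0 < emeasure M A" "emeasure M A < \<infinity>"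
  shows "\<exists>A'\<in>sets C. A' \<subseteq> A \<and> 0 < emeasure M A' \<and> emeasure M A' < emeasure M A"
proof (rule ccontr)
  assume no: "\<not> ?thesis"
  have T: "measure_preserving M T" and cons: "conservative M T"
    and noinv: "\<not> (\<exists>A\<in>sets M. T -` A \<inter> space M = A \<and> 0 < emeasure M A \<and> emeasure M A < \<infinity>)"
    using II by (auto simp: type_II_infty_def)
  have CM: "B \<in> sets M" if "B \<in> sets C" for B using C that by (auto simp: subalgebra_def)
  have Tsp: "T x \<in> space M" if "x \<in> space M" for x
    using T that by (auto simp: measure_preserving_def dest: measurable_space)
  have Tnsp: "(T ^^ n) x \<in> space M" if "x \<in> space M" for n x
    using that by (induction n) (auto intro: Tsp)
  define pre where "pre n B = (T ^^ n) -` B \<inter> space M" for n B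
  have pre_Suc: "pre (Suc n) B = T -` pre n B \<inter> space M" for n B
    using Tsp Tnsp by (auto simp: pre_def funpow_swap1 simp del: funpow.simps(2)) (auto simp: funpow_swap1)
  have pre_add: "pre n (pre m B) = pre (n + m) B" for n m B
    using Tnsp by (auto simp: pre_def funpow_add add.commute[of n m])
  have pre_0: "pre 0 B = B" if "B \<in> sets M" for B
    using sets.sets_into_space[OF that] by (auto simp: pre_def)
  have preC: "pre n B \<in> sets C" if "B \<in> sets C" for n B
  proof (induction n)
    case 0 show ?case using that pre_0[OF CM] by simp
  next
    case (Suc n) then show ?case unfolding pre_Suc by (rule TC)
  qed
  have preM: "pre n B \<in> sets M" "emeasure M (pre n B) = emeasure M B" if "B \<in> sets M" for n B
  proof (induction n)
    case 0
    { case 1 show ?case using that pre_0 by simp }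
    { case 2 show ?case using that pre_0 by simp }
  next
    case (Suc n)
    { case 1 show ?case unfolding pre_Suc using Suc measure_preserving_emeasure[OF T] by simp }
    { case 2 show ?case unfolding pre_Suc using Suc measure_preserving_emeasure[OF T] by simp }
  qed
  have AM: "A \<in> sets M" using A CM by auto
  have "\<exists>n\<ge>1. emeasure M (A \<inter> pre n A) \<noteq> 0"
  proof (rule ccontr)
    assume "\<not> ?thesis"
    then have null: "A \<inter> pre (Suc n) A \<in> null_sets M" for n
      using AM preM(1)[OF AM] by (auto simp: null_sets_def)
    \<comment> \<open>If all returns of \<open>A\<close> were null, deleting them would leave a
      wandering set with the full mass of \<open>A\<close>, against conservativity.\<close>
    define W where "W = A - (\<Union>n. A \<inter> pre (Suc n) A)"
    have "W \<in> sets M" unfolding W_def using AM preM(1)[OF AM] by auto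
    moreover have "W \<inter> (T ^^ n) -` W = {}" if n1: "n \<ge> 1" for n
    proof -
      obtain m where "n = Suc m" using n1 by (cases n) auto
      have "W \<inter> (T ^^ n) -` W \<subseteq> A \<inter> pre (Suc m) A"
        unfolding pre_def \<open>n = Suc m\<close>[symmetric] using sets.sets_into_space[OF AM] by (auto simp: W_def)
      then show ?thesis by (auto simp: W_def)
    qed
    ultimately have "emeasure M W = 0" using cons by (auto simp: conservative_def)
    moreover have "emeasure M W = emeasure M A"
      unfolding W_def using AM null by (intro emeasure_Diff_null_set null_sets_UN) auto
    ultimately show False using A(2) by simp
  qed
  then obtain n where n: "n \<ge> 1" "emeasure M (A \<inter> pre n A) \<noteq> 0" by auto
  have "A \<inter> pre n A \<in> sets C" using A preC by auto
  then have "\<not> emeasure M (A \<inter> pre n A) < emeasure M A"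
    using no n(2) by (auto simp: zero_less_iff_neq_zero)
  moreover have "emeasure M (A \<inter> pre n A) \<le> emeasure M A" using AM by (intro emeasure_mono) auto
  ultimately have eq: "emeasure M (A \<inter> pre n A) = emeasure M A" by auto
  define N where "N = pre n A - A"
  have NM: "N \<in> sets M" unfolding N_def using AM preM(1)[OF AM] by auto
  have "emeasure M (A \<inter> pre n A) + emeasure M N = emeasure M (pre n A)"
  proof -
    have "emeasure M (A \<inter> pre n A) + emeasure M N = emeasure M (A \<inter> pre n A \<union> N)"
      using AM preM(1)[OF AM] NM by (intro plus_emeasure) (auto simp: N_def)
    moreover have "A \<inter> pre n A \<union> N = pre n A" by (auto simp: N_def)
    ultimately show ?thesis by simp
  qed
  then have "emeasure M A + emeasure M N = emeasure M A + 0" using eq preM(2)[OF AM] by simp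
  then have N0: "emeasure M N = 0" using A(3) by (auto simp: ennreal_add_left_cancel)
  \<comment> \<open>Each \<open>pre m A\<close> with \<open>m \<ge> n\<close> lies in
    \<open>pre (m - n) A\<close> up to preimages of the null set \<open>N\<close>, so this one set
    of finite measure contains all of them.\<close>
  define Z where "Z = (\<Union>i<n. pre i A) \<union> (\<Union>m. pre m N)"
  have sub: "pre m A \<subseteq> Z" for m
  proof (induction m rule: less_induct)
    case (less m)
    show ?case
    proof (cases "m < n")
      case True
      then show ?thesis by (auto simp: Z_def)
    next
      case False
      then have "m = (m - n) + n" by simp
      then have "pre m A = pre (m - n) (pre n A)" using pre_add[of "m - n" n A] by simp
      also have "\<dots> \<subseteq> pre (m - n) A \<union> pre (m - n) N" by (auto simp: pre_def N_def)
      also have "\<dots> \<subseteq> Z" using less[of "m - n"] n(1) False by (auto simp: Z_def)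
      finally show ?thesis .
    qed
  qed
  have ZM: "Z \<in> sets M" unfolding Z_def using preM(1)[OF AM] preM(1)[OF NM] by auto
  have "emeasure M (\<Union>m. pre m N) = 0"
    using preM[OF NM] N0 by (intro emeasure_UN_eq_0) auto
  then have "emeasure M Z \<le> emeasure M (\<Union>i<n. pre i A) + 0"
    unfolding Z_def using preM(1)[OF AM] preM(1)[OF NM]
    by (intro order_trans[OF emeasure_subadditive]) auto
  also have "\<dots> \<le> (\<Sum>i<n. emeasure M (pre i A))"
    using preM(1)[OF AM] by (auto intro!: emeasure_subadditive_finite)
  also have "\<dots> < \<infinity>" using preM(2)[OF AM] A(3) by (simp add: ennreal_mult_less_top of_nat_less_top)
  finally have Zfin: "emeasure M Z < \<infinity>" .
  \<comment> \<open>The union of all preimages is invariant only up to a null set, while the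
    definition of type II excludes strictly invariant sets. The preimage of a tail is exactly the
    next tail, so the intersection of the tails is strictly invariant.\<close>
  define U where "U k = (\<Union>m. pre (k + m) A)" for k
  define L where "L = (\<Inter>k. U k)"
  have UM: "U k \<in> sets M" for k unfolding U_def using preM(1)[OF AM] by auto
  have UZ: "U k \<subseteq> Z" for k unfolding U_def using sub by auto
  have decU: "decseq U"
  proof (rule decseq_SucI, rule subsetI)
    fix k x assume "x \<in> U (Suc k)"
    then obtain m where "x \<in> pre (k + Suc m) A" by (auto simp: U_def)
    then show "x \<in> U k" unfolding U_def by blast
  qed
  have Ufin: "emeasure M (U k) \<noteq> \<infinity>" for k
    using emeasure_mono[OF UZ[of k] ZM] Zfin by auto
  have UA: "emeasure M A \<le> emeasure M (U k)" for k
  proof -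
    have "pre (k + 0) A \<subseteq> U k" unfolding U_def by blast
    then show ?thesis using emeasure_mono[OF _ UM, of "pre (k + 0) A" k] preM(2)[OF AM] by simp
  qed
  have LM: "L \<in> sets M" unfolding L_def using UM by auto
  have "emeasure M L = (INF k. emeasure M (U k))"
    unfolding L_def by (rule INF_emeasure_decseq[symmetric, OF _ decU Ufin]) (use UM in auto)
  then have "emeasure M A \<le> emeasure M L" using UA by (auto intro: INF_greatest)
  then have "0 < emeasure M L" using A(2) by auto
  moreover have "emeasure M L < \<infinity>"
    using emeasure_mono[of L Z M] UZ ZM Zfin by (force simp: L_def)
  moreover have "T -` L \<inter> space M = L"
  proof -
    have TU: "T -` U k \<inter> space M = U (Suc k)" for k
      by (auto simp: U_def pre_Suc)
    have "T -` L \<inter> space M = (\<Inter>k. T -` U k \<inter> space M)" by (auto simp: L_def)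
    also have "\<dots> = (\<Inter>k. U (Suc k))" by (simp add: TU)
    also have "\<dots> = L"
      unfolding L_def using decU by (auto simp: decseq_Suc_iff)
    finally show ?thesis .
  qed
  ultimately show False using noinv LM by auto
qed

section \<open>Conditional entropy\<close>

text \<open>Applying \<open>neg_xlnx\<close> gives the summand in \<open>cond_entropy\<close>. The
  conversion to \<open>real\<close> sends an infinite value to 0, so it is faithful only where the
  conditional expectation is finite.\<close>

definition cond_prob :: "'a measure \<Rightarrow> 'a measure \<Rightarrow> 'a set \<Rightarrow> 'a \<Rightarrow> real" where
  "cond_prob M D B x = enn2real (nn_cond_exp M D (indicator B) x)"

context sigma_finite_subalgebra
begin

lemma measurable_cond_prob [measurable]: "cond_prob M F B \<in> borel_measurable F"
  unfolding cond_prob_def by measurable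

text \<open>Comparison with the constant 1, which is its own conditional expectation. The
  exceptional null set is cut out before pointwise estimates are made.\<close>

lemma AE_nn_cond_exp_le_1:
  assumes "B \<in> sets M"
  shows "AE x in M. nn_cond_exp M F (indicator B) x \<le> 1"
proof -
  have [measurable]: "B \<in> sets M" by fact
  have "AE x in M. nn_cond_exp M F (indicator B) x \<le> nn_cond_exp M F (\<lambda>_. 1) x"
    by (rule nn_cond_exp_mono) (auto simp: indicator_def)
  moreover have "AE x in M. 1 = nn_cond_exp M F (\<lambda>_. 1) x"
    by (rule nn_cond_exp_F_meas) simp
  ultimately show ?thesis by eventually_elim simp
qed

text \<open>The conditional expectation integrates over \<open>G\<close> to the mass of
  \<open>G \<inter> B\<close>, so its pointwise bounds become bounds on the share of
  \<open>B\<close> in \<open>G\<close>.\<close>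

lemma cond_prob_bounds:
  assumes G: "G \<in> sets F" "emeasure M G < \<infinity>" and B: "B \<in> sets M"
    and le1: "\<And>x. x \<in> G \<Longrightarrow> nn_cond_exp M F (indicator B) x \<le> 1"
    and l: "0 \<le> l" "\<And>x. x \<in> G \<Longrightarrow> l \<le> cond_prob M F B x"
    and u: "0 \<le> u" "\<And>x. x \<in> G \<Longrightarrow> cond_prob M F B x \<le> u"
  shows "l * measure M G \<le> measure M (G \<inter> B)" "measure M (G \<inter> B) \<le> u * measure M G"
proof -
  have GM [measurable]: "G \<in> sets M" using G(1) subalg by (auto simp: subalgebra_def)
  have [measurable]: "G \<in> sets F" "B \<in> sets M" by fact+
  have q: "nn_cond_exp M F (indicator B) x = ennreal (cond_prob M F B x)" if "x \<in> G" for x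
    unfolding cond_prob_def
    by (rule ennreal_enn2real[symmetric]) (rule le_less_trans[OF le1[OF that] ennreal_one_less_top])
  have fin: "emeasure M (G \<inter> B) \<noteq> \<infinity>" using emeasure_mono[of "G \<inter> B" G M] G(2) by auto
  have "emeasure M (G \<inter> B) = (\<integral>\<^sup>+x. indicator G x * indicator B x \<partial>M)"
    by (simp flip: nn_integral_indicator add: indicator_inter_arith)
  also have "\<dots> = (\<integral>\<^sup>+x. indicator G x * nn_cond_exp M F (indicator B) x \<partial>M)"
    by (rule nn_cond_exp_intg[symmetric]) auto
  finally have eq: "emeasure M (G \<inter> B) = (\<integral>\<^sup>+x. indicator G x * nn_cond_exp M F (indicator B) x \<partial>M)" .
  have "ennreal l * emeasure M G = (\<integral>\<^sup>+x. ennreal l * indicator G x \<partial>M)"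
    by (simp add: nn_integral_cmult_indicator)
  also have "\<dots> \<le> emeasure M (G \<inter> B)"
    unfolding eq by (intro nn_integral_mono) (auto simp: indicator_def q intro!: ennreal_leI l(2))
  finally show "l * measure M G \<le> measure M (G \<inter> B)"
    using l(1) G(2) fin by (simp add: emeasure_eq_ennreal_measure less_top flip: ennreal_mult)
  have "emeasure M (G \<inter> B) \<le> (\<integral>\<^sup>+x. ennreal u * indicator G x \<partial>M)"
    unfolding eq by (intro nn_integral_mono) (auto simp: indicator_def q intro!: ennreal_leI u(2))
  also have "\<dots> = ennreal u * emeasure M G"
    by (simp add: nn_integral_cmult_indicator)
  finally show "measure M (G \<inter> B) \<le> u * measure M G"
    using u(1) G(2) fin by (simp add: emeasure_eq_ennreal_measure less_top flip: ennreal_mult)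
qed

text \<open>A piece is indexed by a cell of the cover \<open>W\<close> and by the integer parts of
  \<open>N\<close> times the conditional probabilities. The first coordinate makes the piece small;
  the second fixes all these probabilities up to \<open>1 / N\<close>.\<close>

lemma level_partition:
  fixes N :: nat and \<epsilon> :: real
  assumes Q: "finite Q" and N: "N > 0" and \<epsilon>: "\<epsilon> > 0"
    and E: "E \<in> sets F" and le1: "\<And>x B. x \<in> E \<Longrightarrow> B \<in> Q \<Longrightarrow> nn_cond_exp M F (indicator B) x \<le> 1"
    and W: "finite W" "W \<subseteq> sets F" "\<Union>W = E" "\<And>B. B \<in> W \<Longrightarrow> emeasure M B \<le> ennreal \<epsilon>"
  obtains J :: "('a set set \<times> ('a set \<Rightarrow> nat)) set" and piece a where
    "finite J" "disjoint_family_on piece J" "(\<Union>j\<in>J. piece j) = E"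
    "\<And>j. j \<in> J \<Longrightarrow> piece j \<in> sets F" "\<And>j. j \<in> J \<Longrightarrow> emeasure M (piece j) \<le> ennreal \<epsilon>"
    "\<And>j B. j \<in> J \<Longrightarrow> B \<in> Q \<Longrightarrow> a j B \<in> {0..1}"
    "\<And>j B x. j \<in> J \<Longrightarrow> B \<in> Q \<Longrightarrow> x \<in> piece j \<Longrightarrow> a j B \<le> cond_prob M F B x"
    "\<And>j B x. j \<in> J \<Longrightarrow> B \<in> Q \<Longrightarrow> x \<in> piece j \<Longrightarrow> cond_prob M F B x \<le> a j B + 1 / N"
proof
  let ?p = "cond_prob M F"
  let ?lev = "\<lambda>B x. nat \<lfloor>real N * ?p B x\<rfloor>"
  let ?J = "cells W \<times> PiE Q (\<lambda>_. {..N})"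
  let ?piece = "\<lambda>(S, \<kappa>). cell W S \<inter> {x \<in> space F. \<forall>B\<in>Q. ?lev B x = \<kappa> B}"
  let ?a = "\<lambda>(S, \<kappa>) B. real (\<kappa> B) / real N"
  have p01: "?p B x \<in> {0..1}" if "x \<in> E" "B \<in> Q" for x B
    using le1[OF that] enn2real_mono[of _ 1] by (auto simp: cond_prob_def enn2real_nonneg)
  have cellE: "cell W S \<subseteq> E" if "S \<in> cells W" for S
    using that W(3) by (auto simp: cells_def cell_def)
  show "finite ?J" using Q W(1) by (auto intro!: finite_PiE finite_cells)
  show "disjoint_family_on ?piece ?J"
    unfolding disjoint_family_on_def
  proof (intro ballI impI)
    fix j j' assume j: "j \<in> ?J" "j' \<in> ?J" "j \<noteq> j'"
    obtain S \<kappa> S' \<kappa>' where jj: "j = (S, \<kappa>)" "j' = (S', \<kappa>')" by (cases j; cases j') auto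
    show "?piece j \<inter> ?piece j' = {}"
    proof (cases "S = S'")
      case False
      then show ?thesis using disjoint_cells[of W] j jj by (auto simp: disjoint_family_on_def)
    next
      case True
      then have "\<kappa> \<noteq> \<kappa>'" using j(3) jj by auto
      then obtain B where "B \<in> Q" "\<kappa> B \<noteq> \<kappa>' B" using j jj PiE_ext[of \<kappa> Q _ \<kappa>'] by fastforce
      then show ?thesis using jj by auto
    qed
  qed
  show "(\<Union>j\<in>?J. ?piece j) = E"
  proof (intro equalityI subsetI)
    fix x assume "x \<in> (\<Union>j\<in>?J. ?piece j)"
    then show "x \<in> E" using cellE by auto
  next
    fix x assume x: "x \<in> E"
    then obtain V where "V \<in> W" "x \<in> V" using W(3) by auto
    then obtain S where S: "S \<in> cells W" "x \<in> cell W S" using UN_cells[of V W] by blast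
    define \<kappa> where "\<kappa> = (\<lambda>B\<in>Q. ?lev B x)"
    have "?lev B x \<le> N" if "B \<in> Q" for B
    proof -
      have "real N * ?p B x \<le> real N" using p01[OF x that] by (simp add: mult_left_le)
      then show ?thesis by (simp add: nat_le_iff floor_le_iff)
    qed
    then have "\<kappa> \<in> PiE Q (\<lambda>_. {..N})" by (auto simp: \<kappa>_def)
    moreover have "x \<in> space F" using x sets.sets_into_space[OF E] by auto
    ultimately show "x \<in> (\<Union>j\<in>?J. ?piece j)"
      using S by (intro UN_I[of "(S, \<kappa>)"]) (auto simp: \<kappa>_def)
  qed
  show "?piece j \<in> sets F" if j: "j \<in> ?J" for j
  proof -
    obtain S \<kappa> where jj: "j = (S, \<kappa>)" by (cases j) auto
    have "cell W S \<in> sets F" using sets_cell[OF W(1,2)] j jj by auto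
    moreover have "{x \<in> space F. \<forall>B\<in>Q. ?lev B x = \<kappa> B} \<in> sets F"
    proof (rule sets.sets_Collect_finite_All[OF _ Q])
      fix B
      show "{x \<in> space F. ?lev B x = \<kappa> B} \<in> sets F" by measurable
    qed
    ultimately show ?thesis using jj by auto
  qed
  show "emeasure M (?piece j) \<le> ennreal \<epsilon>" if j: "j \<in> ?J" for j
  proof -
    obtain S \<kappa> where jj: "j = (S, \<kappa>)" by (cases j) auto
    then have "S \<in> cells W" using j by auto
    then obtain V where V: "V \<in> S" "V \<in> W" by (auto simp: cells_def)
    then have "V \<in> sets M" using W(2) subalg by (auto simp: subalgebra_def)
    moreover have "?piece j \<subseteq> V" using V jj by (auto simp: cell_def)
    ultimately have "emeasure M (?piece j) \<le> emeasure M V" by (intro emeasure_mono)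
    also have "\<dots> \<le> ennreal \<epsilon>" using V W(4) by auto
    finally show ?thesis .
  qed
  fix j B assume j: "j \<in> ?J" and B: "B \<in> Q"
  obtain S \<kappa> where jj: "j = (S, \<kappa>)" by (cases j) auto
  then have "\<kappa> B \<le> N" using j B by auto
  then show "?a j B \<in> {0..1}" using N jj by auto
  fix x assume x: "x \<in> ?piece j"
  then have k: "\<kappa> B = ?lev B x" using jj B by auto
  have "x \<in> E" using x jj j cellE by auto
  then have "0 \<le> real N * ?p B x" using p01[OF _ B] by auto
  then have "real (\<kappa> B) \<le> real N * ?p B x" "real N * ?p B x \<le> real (\<kappa> B) + 1"
    unfolding k by linarith+
  then show "?a j B \<le> ?p B x" "?p B x \<le> ?a j B + 1 / N"
    using N jj by (auto simp: field_simps)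
qed

end

section \<open>From conditional entropy to Poisson entropy\<close>

context poisson_process
begin

lemma set_integral_le_ks_entropy:
  assumes T: "measure_preserving M T"
    and C: "sets C \<subseteq> sets M" and D: "sigma_finite_subalgebra M D"
    and TC: "\<And>B. B \<in> sets C \<Longrightarrow> T -` B \<inter> space M \<in> sets D"
    and DC: "sets D \<subseteq> sets C"
    and split: "\<And>B. B \<in> sets D \<Longrightarrow> 0 < emeasure M B \<Longrightarrow> emeasure M B < \<infinity> \<Longrightarrow>
      \<exists>B'\<in>sets D. B' \<subseteq> B \<and> 0 < emeasure M B' \<and> emeasure M B' < emeasure M B"
    and Q: "finite Q" "Q \<subseteq> sets C" "disjoint Q" "\<Union>Q = space M"
    and E: "E \<in> sets D" "emeasure M E < \<infinity>"
    and le1: "\<And>x B. x \<in> E \<Longrightarrow> B \<in> Q \<Longrightarrow> nn_cond_exp M D (indicator B) x \<le> 1"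
  shows "(\<integral>\<^sup>+x. ennreal (\<Sum>B\<in>Q. neg_xlnx (cond_prob M D B x)) * indicator E x \<partial>M)
    \<le> ks_entropy P (push_counting M T)"
proof (rule ennreal_le_epsilon)
  fix \<eta> :: real assume \<eta>: "\<eta> > 0"
  interpret sigma_finite_subalgebra M D by fact
  define m where "m = real (card Q)"
  \<comment> \<open>The 3 pays for three errors of at most \<open>m * \<epsilon>\<close> per unit of
    mass: rounding in the integrand, the loss per label in the gain, and the factor
    \<open>exp (- \<mu> j)\<close>. The summand 1 keeps the denominator positive. The same
    \<open>\<epsilon>\<close> bounds the oscillation of \<open>neg_xlnx\<close> and the mass of a
    piece.\<close>
  define \<epsilon> where "\<epsilon> = \<eta> / (3 * m * measure M E + 1)"
  have pos: "3 * m * measure M E + 1 > 0" by (simp add: m_def add_nonneg_pos)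
  then have \<epsilon>: "\<epsilon> > 0" "3 * m * measure M E * \<epsilon> \<le> \<eta>"
    using \<eta> by (auto simp: \<epsilon>_def field_simps m_def)
  obtain N :: nat where N: "N > 0" and
    mod: "\<And>x y. x \<in> {0..1} \<Longrightarrow> y \<in> {0..1} \<Longrightarrow> \<bar>x - y\<bar> \<le> 1 / N \<Longrightarrow> \<bar>neg_xlnx x - neg_xlnx y\<bar> \<le> \<epsilon>"
    using neg_xlnx_modulus[OF \<epsilon>(1)] by blast
  have "\<exists>W. finite W \<and> W \<subseteq> sets D \<and> \<Union>W = E \<and> (\<forall>B\<in>W. emeasure M B \<le> ennreal \<epsilon>)"
  proof (rule finite_small_cover[OF subalg E \<epsilon>(1)])
    fix B assume B: "B \<in> sets D" "B \<subseteq> E" "0 < emeasure M B"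
    have "E \<in> sets M" using E(1) subalg by (auto simp: subalgebra_def)
    then have "emeasure M B < \<infinity>" using E(2) emeasure_mono[OF B(2)] by (meson le_less_trans)
    then show "\<exists>B'\<in>sets D. B' \<subseteq> B \<and> 0 < emeasure M B' \<and> emeasure M B' \<le> ennreal \<epsilon>"
      using B by (intro small_subset[OF subalg split] \<epsilon>(1))
  qed
  then obtain W where W: "finite W" "W \<subseteq> sets D" "\<Union>W = E" "\<And>B. B \<in> W \<Longrightarrow> emeasure M B \<le> ennreal \<epsilon>"
    by blast
  obtain J :: "('a set set \<times> ('a set \<Rightarrow> nat)) set" and piece a where
    J: "finite J" and disj: "disjoint_family_on piece J" and UN: "(\<Union>j\<in>J. piece j) = E"
    and pD: "\<And>j. j \<in> J \<Longrightarrow> piece j \<in> sets D" and small: "\<And>j. j \<in> J \<Longrightarrow> emeasure M (piece j) \<le> ennreal \<epsilon>"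
    and a01: "\<And>j B. j \<in> J \<Longrightarrow> B \<in> Q \<Longrightarrow> a j B \<in> {0..1}"
    and al: "\<And>j B x. j \<in> J \<Longrightarrow> B \<in> Q \<Longrightarrow> x \<in> piece j \<Longrightarrow> a j B \<le> cond_prob M D B x"
    and au: "\<And>j B x. j \<in> J \<Longrightarrow> B \<in> Q \<Longrightarrow> x \<in> piece j \<Longrightarrow> cond_prob M D B x \<le> a j B + 1 / N"
    by (rule level_partition[OF Q(1) N \<epsilon>(1) E(1) le1 W]) blast+
  have QM: "Q \<subseteq> sets M" using Q C by auto
  have DM: "B \<in> sets M" if "B \<in> sets D" for B using that subalg by (auto simp: subalgebra_def)
  have pE: "piece j \<subseteq> E" if "j \<in> J" for j using UN that by auto
  have fin: "piece j \<in> finsets" if "j \<in> J" for j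
    unfolding finsets_def using emeasure_mono[OF pE[OF that] DM[OF E(1)]] E(2) DM[OF pD[OF that]] by auto
  define \<mu> where "\<mu> j = measure M (piece j)" for j
  have \<mu>: "emeasure M (piece j) = ennreal (\<mu> j)" "0 \<le> \<mu> j" "\<mu> j \<le> \<epsilon>" if "j \<in> J" for j
  proof -
    show 1: "emeasure M (piece j) = ennreal (\<mu> j)"
      unfolding \<mu>_def using fin[OF that] by (intro emeasure_eq_ennreal_measure) (auto simp: finsets_def)
    show "0 \<le> \<mu> j" by (simp add: \<mu>_def)
    show "\<mu> j \<le> \<epsilon>" using small[OF that] \<epsilon>(1) unfolding 1 by (simp add: ennreal_le_iff)
  qed
  have sum\<mu>: "(\<Sum>j\<in>J. \<mu> j) = measure M E"
  proof -
    have "measure M (\<Union>j\<in>J. piece j) = (\<Sum>j\<in>J. measure M (piece j))"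
    proof (rule measure_finite_Union[OF J _ disj])
      show "piece ` J \<subseteq> sets M" using DM pD by blast
      show "emeasure M (piece j) \<noteq> \<infinity>" if "j \<in> J" for j using fin[OF that] by (auto simp: finsets_def)
    qed
    then show ?thesis unfolding UN by (simp add: \<mu>_def)
  qed
  define w where "w j = (\<Sum>B\<in>Q. neg_xlnx (a j B))" for j
  have w: "0 \<le> w j" "w j \<le> m" if "j \<in> J" for j
  proof -
    show "0 \<le> w j" unfolding w_def using a01[OF that] by (intro sum_nonneg neg_xlnx_nonneg) auto
    have "w j \<le> (\<Sum>B\<in>Q. 1)" unfolding w_def using a01[OF that] by (intro sum_mono neg_xlnx_le_1) auto
    then show "w j \<le> m" by (simp add: m_def)
  qed
  have m0: "0 \<le> m" by (simp add: m_def)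
  let ?c = "\<Sum>j\<in>J. \<mu> j * exp (- \<mu> j) * (\<Sum>B\<in>Q. neg_xlnx (a j B) - \<epsilon>)"
  let ?g = "\<lambda>x. \<Sum>B\<in>Q. neg_xlnx (cond_prob M D B x)"
  have "(\<integral>\<^sup>+x. ennreal (?g x) * indicator E x \<partial>M)
      \<le> (\<integral>\<^sup>+x. (\<Sum>j\<in>J. ennreal (w j + m * \<epsilon>) * indicator (piece j) x) \<partial>M)"
  proof (rule nn_integral_mono)
    fix x
    show "ennreal (?g x) * indicator E x \<le> (\<Sum>j\<in>J. ennreal (w j + m * \<epsilon>) * indicator (piece j) x)"
    proof (cases "x \<in> E")
      case True
      then obtain j where j: "j \<in> J" "x \<in> piece j" using UN by auto
      have "?g x \<le> (\<Sum>B\<in>Q. neg_xlnx (a j B) + \<epsilon>)"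
      proof (rule sum_mono)
        fix B assume B: "B \<in> Q"
        have "cond_prob M D B x \<in> {0..1}"
          using enn2real_mono[OF le1[OF True B]] by (simp add: cond_prob_def enn2real_nonneg)
        then have "\<bar>neg_xlnx (cond_prob M D B x) - neg_xlnx (a j B)\<bar> \<le> \<epsilon>"
          using al[OF j(1) B j(2)] au[OF j(1) B j(2)] by (intro mod a01 j B) auto
        then show "neg_xlnx (cond_prob M D B x) \<le> neg_xlnx (a j B) + \<epsilon>" by simp
      qed
      also have "\<dots> = w j + m * \<epsilon>" by (simp add: w_def m_def sum.distrib)
      finally have "ennreal (?g x) * indicator E x \<le> ennreal (w j + m * \<epsilon>) * indicator (piece j) x"
        using True j(2) by (simp add: ennreal_leI)
      also have "\<dots> \<le> (\<Sum>j\<in>J. ennreal (w j + m * \<epsilon>) * indicator (piece j) x)"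
        using J j(1) by (intro member_le_sum) auto
      finally show ?thesis .
    qed simp
  qed
  also have "\<dots> = (\<Sum>j\<in>J. \<integral>\<^sup>+x. ennreal (w j + m * \<epsilon>) * indicator (piece j) x \<partial>M)"
    using DM[OF pD] by (intro nn_integral_sum) auto
  also have "\<dots> = (\<Sum>j\<in>J. ennreal ((w j + m * \<epsilon>) * \<mu> j))"
  proof (rule sum.cong[OF refl])
    fix j assume j: "j \<in> J"
    show "(\<integral>\<^sup>+x. ennreal (w j + m * \<epsilon>) * indicator (piece j) x \<partial>M) = ennreal ((w j + m * \<epsilon>) * \<mu> j)"
    proof -
      have "(\<integral>\<^sup>+x. ennreal (w j + m * \<epsilon>) * indicator (piece j) x \<partial>M) = ennreal (w j + m * \<epsilon>) * ennreal (\<mu> j)"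
        using DM[OF pD[OF j]] by (simp only: nn_integral_cmult_indicator \<mu>(1)[OF j])
      also have "\<dots> = ennreal ((w j + m * \<epsilon>) * \<mu> j)"
        using \<mu>[OF j] w[OF j] \<epsilon>(1) m0 by (intro ennreal_mult[symmetric]) auto
      finally show ?thesis .
    qed
  qed
  also have "\<dots> = ennreal (\<Sum>j\<in>J. (w j + m * \<epsilon>) * \<mu> j)"
    using \<mu> w \<epsilon>(1) m0 by (intro sum_ennreal) auto
  also have "\<dots> \<le> ennreal (?c + \<eta>)"
  proof (rule ennreal_leI)
    have "(w j + m * \<epsilon>) * \<mu> j \<le> \<mu> j * exp (- \<mu> j) * (\<Sum>B\<in>Q. neg_xlnx (a j B) - \<epsilon>) + \<mu> j * (3 * m * \<epsilon>)" if j: "j \<in> J" for j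
    proof -
      have s: "(\<Sum>B\<in>Q. neg_xlnx (a j B) - \<epsilon>) = w j - m * \<epsilon>" by (simp add: w_def m_def sum_subtractf)
      \<comment> \<open>Smallness of the pieces enters here: the one-point probability is at least
        \<open>1 - \<epsilon>\<close> times the mass of the piece.\<close>
      have "1 - \<epsilon> \<le> exp (- \<mu> j)" using exp_ge_add_one_self[of "- \<mu> j"] \<mu>(3)[OF j] by linarith
      then have "w j * (1 - \<epsilon>) \<le> w j * exp (- \<mu> j)" using w[OF j] by (intro mult_left_mono) auto
      moreover have "m * \<epsilon> * exp (- \<mu> j) \<le> m * \<epsilon> * 1"
        using \<mu>(2)[OF j] m0 \<epsilon>(1) by (intro mult_left_mono) auto
      moreover have "w j * \<epsilon> \<le> m * \<epsilon>" using w[OF j] \<epsilon>(1) by (intro mult_right_mono) auto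
      ultimately have "w j + m * \<epsilon> \<le> exp (- \<mu> j) * (w j - m * \<epsilon>) + 3 * m * \<epsilon>" by (simp add: algebra_simps)
      then have "\<mu> j * (w j + m * \<epsilon>) \<le> \<mu> j * (exp (- \<mu> j) * (w j - m * \<epsilon>) + 3 * m * \<epsilon>)"
        using \<mu>(2)[OF j] by (rule mult_left_mono)
      then show ?thesis unfolding s by (simp add: algebra_simps)
    qed
    then have "(\<Sum>j\<in>J. (w j + m * \<epsilon>) * \<mu> j) \<le> (\<Sum>j\<in>J. \<mu> j * exp (- \<mu> j) * (\<Sum>B\<in>Q. neg_xlnx (a j B) - \<epsilon>) + \<mu> j * (3 * m * \<epsilon>))"
      by (rule sum_mono)
    also have "\<dots> = ?c + measure M E * (3 * m * \<epsilon>)"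
      by (simp add: sum.distrib sum_distrib_right[symmetric] sum\<mu>)
    also have "\<dots> \<le> ?c + \<eta>" using \<epsilon>(2) by (simp add: mult_ac)
    finally show "(\<Sum>j\<in>J. (w j + m * \<epsilon>) * \<mu> j) \<le> ?c + \<eta>" .
  qed
  \<comment> \<open>The subtracted errors may make \<open>?c\<close> negative; then
    \<open>ennreal ?c\<close> is 0 and \<open>\<eta>\<close> alone dominates.\<close>
  also have "\<dots> \<le> ennreal ?c + ennreal \<eta>" using \<eta> by (cases "?c \<ge> 0") (auto simp: ennreal_neg ennreal_leI)
  also have "ennreal ?c \<le> ks_entropy P (push_counting M T)"
    unfolding \<mu>_def
  proof (rule ks_entropy_ge_labels[OF T C TC DC Q J _ disj a01 _ _ _ mod])
    show "piece j \<in> finsets \<and> piece j \<in> sets D" if "j \<in> J" for j using fin pD that by auto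
    fix j B G assume j: "j \<in> J" and B: "B \<in> Q" and G: "G \<in> sets D" "G \<subseteq> piece j"
    have BM: "B \<in> sets M" using B QM by auto
    have "emeasure M G < \<infinity>" using finsets_subset[OF fin[OF j] DM[OF G(1)] G(2)] by (simp add: finsets_def)
    moreover have "nn_cond_exp M D (indicator B) x \<le> 1" if "x \<in> G" for x
      using le1[OF _ B] pE[OF j] G(2) that by blast
    moreover have "a j B \<le> cond_prob M D B x" "cond_prob M D B x \<le> a j B + 1 / N" if "x \<in> G" for x
      using al[OF j B] au[OF j B] G(2) that by blast+
    moreover have "0 \<le> a j B" using a01[OF j B] by simp
    moreover from this have "0 \<le> a j B + 1 / N" by simp
    ultimately show "a j B * measure M G \<le> measure M (G \<inter> B)" "measure M (G \<inter> B) \<le> (a j B + 1 / N) * measure M G"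
      using cond_prob_bounds[OF G(1) _ BM, of "a j B" "a j B + 1 / N"] by simp_all
  qed auto
  finally show "(\<integral>\<^sup>+x. ennreal (?g x) * indicator E x \<partial>M) \<le> ks_entropy P (push_counting M T) + ennreal \<eta>"
    by (simp add: add_right_mono)
qed

lemma cond_entropy_le_ks_entropy:
  assumes II: "type_II_infty M T" and C: "sigma_finite_subalgebra M C"
    and inv: "sets (vimage_algebra (space M) T C) \<subseteq> sets C"
  shows "cond_entropy M C (vimage_algebra (space M) T C) \<le> ks_entropy P (push_counting M T)"
proof -
  let ?D = "vimage_algebra (space M) T C"
  interpret C: sigma_finite_subalgebra M C by fact
  have T: "measure_preserving M T" using II by (simp add: type_II_infty_def)
  have TM: "T \<in> M \<rightarrow>\<^sub>M M" using T by (simp add: measure_preserving_def)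
  have CM: "sets C \<subseteq> sets M" "space C = space M" using C.subalg by (auto simp: subalgebra_def)
  have "T \<in> space M \<rightarrow> space C" using measurable_space[OF TM] CM(2) by auto
  then have sD: "sets ?D = {T -` A \<inter> space M | A. A \<in> sets C}" by (rule sets_vimage_algebra2)
  then have TC: "T -` B \<inter> space M \<in> sets ?D" if "B \<in> sets C" for B using that by auto
  have subD: "subalgebra M ?D" using inv CM by (auto simp: subalgebra_def)
  have DM: "B \<in> sets M" if "B \<in> sets ?D" for B using that subD by (auto simp: subalgebra_def)
  have eT: "emeasure M (T -` A \<inter> space M) = emeasure M A" if "A \<in> sets C" for A
    using measure_preserving_emeasure(2)[OF T] that CM by auto
  interpret RC: sigma_finite_measure "restr_to_subalg M C" by (rule C.sigma_fin_subalg)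
  obtain A :: "nat \<Rightarrow> 'a set" where A: "range A \<subseteq> sets (restr_to_subalg M C)"
    "(\<Union>i. A i) = space (restr_to_subalg M C)" "\<And>i. emeasure (restr_to_subalg M C) (A i) \<noteq> \<infinity>" "incseq A"
    by (rule RC.sigma_finite_incseq) blast
  have AC: "A i \<in> sets C" for i using A(1) by (auto simp: sets_restr_to_subalg[OF C.subalg])
  \<comment> \<open>Preimages of an exhaustion of the space by sets of \<open>C\<close> of finite
    measure: they show that \<open>?D\<close> is sigma-finite and later allow monotone
    convergence.\<close>
  define B where "B i = T -` A i \<inter> space M" for i
  have BD: "B i \<in> sets ?D" for i unfolding B_def using TC AC by auto
  have Bfin: "emeasure M (B i) < \<infinity>" for i
    using A(3)[of i] emeasure_restr_to_subalg[OF C.subalg AC] eT[OF AC] by (simp add: B_def less_top)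
  have BUN: "(\<Union>i. B i) = space M"
  proof -
    have "(\<Union>i. B i) = T -` (\<Union>i. A i) \<inter> space M" by (auto simp: B_def)
    also have "\<dots> = space M"
      using A(2) measurable_space[OF TM] by (auto simp: space_restr_to_subalg)
    finally show ?thesis .
  qed
  have Binc: "incseq B" using A(4) unfolding B_def incseq_def by blast
  have D: "sigma_finite_subalgebra M ?D"
  proof
    show "subalgebra M ?D" by fact
    show "\<exists>X. countable X \<and> X \<subseteq> sets (restr_to_subalg M ?D) \<and> \<Union>X = space (restr_to_subalg M ?D) \<and>
        (\<forall>a\<in>X. emeasure (restr_to_subalg M ?D) a \<noteq> \<infinity>)"
      using BD BUN Bfin
      by (intro exI[of _ "range B"])
        (auto simp: sets_restr_to_subalg[OF subD] space_restr_to_subalg emeasure_restr_to_subalg[OF subD] less_top)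
  qed
  interpret D: sigma_finite_subalgebra M ?D by fact
  \<comment> \<open>Every member of \<open>?D\<close> is the preimage of a set of \<open>C\<close>
    with the same mass, so absence of atoms passes from \<open>C\<close> to
    \<open>?D\<close>.\<close>
  have split: "\<exists>B'\<in>sets ?D. B' \<subseteq> B \<and> 0 < emeasure M B' \<and> emeasure M B' < emeasure M B"
    if B: "B \<in> sets ?D" "0 < emeasure M B" "emeasure M B < \<infinity>" for B
  proof -
    obtain A where A: "A \<in> sets C" "B = T -` A \<inter> space M" using B(1) sD by auto
    have "\<exists>A'\<in>sets C. A' \<subseteq> A \<and> 0 < emeasure M A' \<and> emeasure M A' < emeasure M A"
    proof (rule type_II_infty_no_atom[OF II C.subalg _ A(1)])
      show "T -` A' \<inter> space M \<in> sets C" if "A' \<in> sets C" for A' using TC[OF that] inv by auto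
    qed (use B(2,3) eT[OF A(1)] A(2) in auto)
    then obtain A' where A': "A' \<in> sets C" "A' \<subseteq> A" "0 < emeasure M A'" "emeasure M A' < emeasure M A"
      by blast
    then have "T -` A' \<inter> space M \<subseteq> B" using A(2) by auto
    then show ?thesis
      using TC[OF A'(1)] A'(3,4) eT[OF A(1)] eT[OF A'(1)] A(2) by (intro bexI[of _ "T -` A' \<inter> space M"]) simp_all
  qed
  show ?thesis
    unfolding cond_entropy_def
  proof (rule SUP_least)
    fix Q assume "Q \<in> {P. finite P \<and> P \<subseteq> sets C \<and> disjoint P \<and> \<Union>P = space M}"
    then have Q: "finite Q" "Q \<subseteq> sets C" "disjoint Q" "\<Union>Q = space M" by auto
    let ?g = "\<lambda>x. ennreal (\<Sum>B\<in>Q. neg_xlnx (cond_prob M ?D B x))"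
    have [measurable]: "cond_prob M ?D B \<in> borel_measurable M" for B
      using subD D.measurable_cond_prob by (rule measurable_from_subalg)
    have gM [measurable]: "?g \<in> borel_measurable M" by measurable
    \<comment> \<open>This set is null and lies in \<open>?D\<close>; deleting it from
      \<open>B i\<close> changes no integral and leaves a member of \<open>?D\<close> on which the
      pointwise bound by 1 holds.\<close>
    define bad where "bad = {x \<in> space ?D. \<not> (\<forall>B\<in>Q. nn_cond_exp M ?D (indicator B) x \<le> 1)}"
    have badD: "bad \<in> sets ?D"
      unfolding bad_def
    proof (rule sets.sets_Collect_neg, rule sets.sets_Collect_finite_All[OF _ Q(1)])
      fix B show "{x \<in> space ?D. nn_cond_exp M ?D (indicator B) x \<le> 1} \<in> sets ?D" by measurable
    qed
    have "AE x in M. \<forall>B\<in>Q. nn_cond_exp M ?D (indicator B) x \<le> 1"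
      using Q CM by (intro AE_finite_allI D.AE_nn_cond_exp_le_1) auto
    then have good: "AE x in M. x \<notin> bad" by eventually_elim (auto simp: bad_def)
    have BM [measurable]: "B i \<in> sets M" for i using BD DM by auto
    have piece: "(\<integral>\<^sup>+x. ?g x * indicator (B i) x \<partial>M) \<le> ks_entropy P (push_counting M T)" for i
    proof -
      have "(\<integral>\<^sup>+x. ?g x * indicator (B i) x \<partial>M) = (\<integral>\<^sup>+x. ?g x * indicator (B i - bad) x \<partial>M)"
        using good by (intro nn_integral_cong_AE) (auto elim!: eventually_mono simp: indicator_def)
      also have "\<dots> \<le> ks_entropy P (push_counting M T)"
      proof (rule set_integral_le_ks_entropy[OF T CM(1) D TC inv split Q])
        show "B i - bad \<in> sets ?D" using BD badD by auto
        have "emeasure M (B i - bad) \<le> emeasure M (B i)" by (intro emeasure_mono) auto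
        then show "emeasure M (B i - bad) < \<infinity>" using Bfin[of i] by (rule le_less_trans)
        show "nn_cond_exp M ?D (indicator B') x \<le> 1" if "x \<in> B i - bad" "B' \<in> Q" for x B'
          using that by (auto simp: bad_def B_def)
      qed
      finally show ?thesis .
    qed
    have sup: "(SUP i. ?g x * indicator (B i) x) = ?g x" if x: "x \<in> space M" for x
    proof (rule antisym)
      show "(SUP i. ?g x * indicator (B i) x) \<le> ?g x"
        by (intro SUP_least) (auto simp: indicator_def)
      obtain i where "x \<in> B i" using x BUN by blast
      then show "?g x \<le> (SUP i. ?g x * indicator (B i) x)" by (intro SUP_upper2[of i]) simp_all
    qed
    have "(\<integral>\<^sup>+x. ?g x \<partial>M) = (\<integral>\<^sup>+x. (SUP i. ?g x * indicator (B i) x) \<partial>M)"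
      using sup by (intro nn_integral_cong) auto
    also have "\<dots> = (SUP i. \<integral>\<^sup>+x. ?g x * indicator (B i) x \<partial>M)"
    proof (rule nn_integral_monotone_convergence_SUP)
      show "incseq (\<lambda>i x. ?g x * indicator (B i) x)"
        using Binc unfolding incseq_def le_fun_def
        by (intro allI impI mult_left_mono) (auto simp: indicator_def)
    qed measurable
    also have "\<dots> \<le> ks_entropy P (push_counting M T)" using piece by (intro SUP_least)
    finally show "(\<integral>\<^sup>+x. ennreal (\<Sum>A\<in>Q. - enn2real (nn_cond_exp M ?D (indicator A) x)
          * ln (enn2real (nn_cond_exp M ?D (indicator A) x))) \<partial>M) \<le> ks_entropy P (push_counting M T)"
      by (simp add: neg_xlnx_def cond_prob_def)
  qed
qed

end

theorem theorem5p2: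
  fixes M :: "'a::polish_space measure" and T :: "'a \<Rightarrow> 'a"
    and P :: "('a set \<Rightarrow> ennreal) measure"
  assumes "sets M = sets borel"
    and "sigma_finite_measure M"
    and "type_II_infty M T"
    and "is_poisson_measure M P"
  shows "parry_entropy M T \<le> ks_entropy P (push_counting M T)"
proof -
  interpret poisson_process M P by standard (rule assms(4))
  show ?thesis
    unfolding parry_entropy_def
    using cond_entropy_le_ks_entropy[OF assms(3)] by (intro SUP_least) auto
qed

end
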